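(* Let $(V,E)$ be a digraph with $d_w\ge2$ for all $w\in V$ and let $L$ be a directed circuit that does not go through every vertex in $V$. Let $u$ be a vertex outside $L$ and $v$ a vertex in $L$, and assume that there exists a directed path from $u$ to $v$. Consider a GD-IFS on $\mathbb{R}$ based on $(V,E)$ satisfying the COSC, with attractors $(F_w)_{w\in V}$, basic gap lengths $\lambda_w^{(k)}$ ($w\in V$, $1\le k\le d_w-1$) and sets $\Lambda_w$ of positive basic gap lengths. Let $A(L)$ (resp. $A(L^c)$) be the set of absolute values of the contraction ratios of the similarities associated with the edges in $L$ (resp. the edges not in $L$). Suppose that: $(i)$ $(A(L))^{\mathbb{Q}^*}\cap(A(L^c))^{\mathbb{Q}_+^*}=\emptyset$; $(ii)$ $\Lambda_u\ne\emptyset$ and $\Lambda_v\neq\emptyset$; $(iii)$ for all pairs $(w,k)\ne(z,m)$ with $w,z\in V$, $1\le k\le d_w-1$, $1\le m\le d_z-1$ and $\lambda_z^{(m)}\ne0$, one has $\lambda_w^{(k)}/\lambda_z^{(m)}\notin(A(L)\cup A(L^c))^{\mathbb{Q}}$. Then $F_u$ is not the attractor of any standard IFS on $\mathbb{R}$ satisfying the COSC.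
   Context: **Digraphs.** A digraph $(V,E)$ has finitely many vertices and directed edges (loops and multiple edges allowed). $E_{uv}$ is the set of edges from $u$ to $v$, $\omega(e)$ is the terminal vertex of the edge $e$, and $d_u$ is the number of edges leaving $u$. A directed path is a finite sequence $e_1\cdots e_k$ ($k\ge1$) of edges with the terminal vertex of $e_i$ equal to the initial vertex of $e_{i+1}$; a directed circuit is a directed path whose initial and terminal vertices coincide. **GD-IFS.** A GD-IFS on $\mathbb{R}$ based on $(V,E)$ is a family $(S_e)_{e\in E}$ of contracting similarities of $\mathbb{R}$ with contraction ratios $\rho_e\in(-1,1)\setminus\{0\}$, $S_e(t)=\rho_et+c_e$. Its attractors are the unique nonempty compact sets $(F_u)_{u\in V}$ with $F_u=\bigcup_{v\in V}\bigcup_{e\in E_{uv}}S_e(F_v)$ for all $u\in V$. It satisfies the COSC (convex open set condition) if there are nonempty bounded convex open sets $(U_u)_{u\in V}$ with $\bigcup_{v\in V}\bigcup_{e\in E_{uv}}S_e(U_v)\subset U_u$, the union being disjoint, for each $u\in V$; one can then take $U_u=\mathrm{int}(\mathrm{conv}\,F_u)$. **Standard IFS.** A standard IFS on $\mathbb{R}$ is a finite set of distinct contracting similarities $\{S_i\}$ of $\mathbb{R}$ (ratios in $(-1,1)\setminus\{0\}$); its attractor is the unique nonempty compact $K$ with $K=\bigcup_i S_i(K)$. It satisfies the COSC if there is a nonempty convex open set $U$ with $\bigcup_i S_i(U)\subseteq U$, the union being disjoint (equivalently one can take $U=\mathrm{int}(\mathrm{conv}\,K)$). **Basic gaps.** For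 a COSC GD-IFS and $u\in V$, the intervals $S_e(\mathrm{conv}\,F_{\omega(e)})$, $e$ leaving $u$, have disjoint interiors; rank them from left to right. For $1\le k\le d_u-1$, $\lambda_u^{(k)}\ge0$ is the length of the (possibly empty) complementary open interval between the $k$th and $(k+1)$th of them, and $\Lambda_u=\{\lambda_u^{(k)}:\lambda_u^{(k)}>0,\ 1\le k\le d_u-1\}$. **Power sets.** For a finite set $A=\{a_1,\dots,a_n\}\subset(0,\infty)$ (distinct $a_i$), $A^{\mathbb{Q}^*}$ (resp. $A^{\mathbb{Q}_+^*}$) is the set of all products $\prod_{i=1}^n a_i^{m_i}$ with $(m_i)$ a non-zero vector of rationals (resp. of nonnegative rationals), and $A^{\mathbb{Q}}=\{1\}\cup A^{\mathbb{Q}^*}$. *)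

theory Defs
  imports "HOL-Analysis.Analysis" "Graph_Theory.Arc_Walk"
begin

definition affine_map :: "real \<Rightarrow> real \<Rightarrow> real \<Rightarrow> real" where
  "affine_map r b t = r * t + b"

definition contraction_ratio :: "real \<Rightarrow> bool" where
  "contraction_ratio r \<longleftrightarrow> r \<in> {-1<..<1} - {0}"


text \<open>
  A graph-directed IFS on the line is given by the digraph \<open>G\<close>, the contraction ratios \<open>\<rho>\<close> and
  the translations \<open>c\<close>: the similarity of the arc \<open>e\<close> is \<open>t \<mapsto> \<rho> e * t + c e\<close>. The arcs run from
  \<open>tail G e\<close> to \<open>head G e\<close>, so that \<open>head G e\<close> is \<open>\<omega>(e)\<close>, and \<open>out_arcs G u\<close> is the union of the
  \<open>E\<^sub>u\<^sub>v\<close> over all vertices \<open>v\<close>.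
\<close>

definition gd_ifs :: "('a, 'b) pre_digraph \<Rightarrow> ('b \<Rightarrow> real) \<Rightarrow> ('b \<Rightarrow> real) \<Rightarrow> bool" where
  "gd_ifs G \<rho> c \<longleftrightarrow> fin_digraph G \<and> (\<forall>e\<in>arcs G. contraction_ratio (\<rho> e))"

definition gd_attractors ::
  "('a, 'b) pre_digraph \<Rightarrow> ('b \<Rightarrow> real) \<Rightarrow> ('b \<Rightarrow> real) \<Rightarrow> ('a \<Rightarrow> real set) \<Rightarrow> bool" where
  "gd_attractors G \<rho> c F \<longleftrightarrow>
     (\<forall>u\<in>verts G. F u \<noteq> {} \<and> compact (F u) \<and>
        F u = (\<Union>e\<in>out_arcs G u. affine_map (\<rho> e) (c e) ` F (head G e)))"

definition gd_cosc ::
  "('a, 'b) pre_digraph \<Rightarrow> ('b \<Rightarrow> real) \<Rightarrow> ('b \<Rightarrow> real) \<Rightarrow> bool" where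
  "gd_cosc G \<rho> c \<longleftrightarrow>
     (\<exists>U :: 'a \<Rightarrow> real set. \<forall>u\<in>verts G.
        U u \<noteq> {} \<and> bounded (U u) \<and> convex (U u) \<and> open (U u) \<and>
        (\<Union>e\<in>out_arcs G u. affine_map (\<rho> e) (c e) ` U (head G e)) \<subseteq> U u \<and>
        disjoint_family_on (\<lambda>e. affine_map (\<rho> e) (c e) ` U (head G e)) (out_arcs G u))"


text \<open>A standard IFS is a set of maps, so its members are automatically distinct.\<close>

definition std_ifs :: "(real \<Rightarrow> real) set \<Rightarrow> bool" where
  "std_ifs \<Phi> \<longleftrightarrow> finite \<Phi> \<and> (\<forall>f\<in>\<Phi>. \<exists>r b. contraction_ratio r \<and> f = affine_map r b)"

definition std_attractor :: "(real \<Rightarrow> real) set \<Rightarrow> real set \<Rightarrow> bool" where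
  "std_attractor \<Phi> K \<longleftrightarrow> K \<noteq> {} \<and> compact K \<and> K = (\<Union>f\<in>\<Phi>. f ` K)"

definition std_cosc :: "(real \<Rightarrow> real) set \<Rightarrow> bool" where
  "std_cosc \<Phi> \<longleftrightarrow>
     (\<exists>U :: real set. U \<noteq> {} \<and> convex U \<and> open U \<and>
        (\<Union>f\<in>\<Phi>. f ` U) \<subseteq> U \<and> disjoint_family_on (\<lambda>f. f ` U) \<Phi>)"


definition basic_interval ::
  "('a, 'b) pre_digraph \<Rightarrow> ('b \<Rightarrow> real) \<Rightarrow> ('b \<Rightarrow> real) \<Rightarrow> ('a \<Rightarrow> real set) \<Rightarrow> 'b \<Rightarrow> real set" where
  "basic_interval G \<rho> c F e = affine_map (\<rho> e) (c e) ` (convex hull (F (head G e)))"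

text \<open>
  The arcs leaving \<open>u\<close>, listed so that their basic intervals run from left to right. If every
  vertex has out-degree at least 2 and the COSC holds, then the basic intervals are nondegenerate
  with disjoint interiors, so exactly one list qualifies.
\<close>

definition ranked_arcs ::
  "('a, 'b) pre_digraph \<Rightarrow> ('b \<Rightarrow> real) \<Rightarrow> ('b \<Rightarrow> real) \<Rightarrow> ('a \<Rightarrow> real set) \<Rightarrow> 'a \<Rightarrow> 'b list" where
  "ranked_arcs G \<rho> c F u =
     (THE es. distinct es \<and> set es = out_arcs G u \<and>
        sorted_wrt (\<lambda>e e'. \<forall>x\<in>basic_interval G \<rho> c F e. \<forall>y\<in>basic_interval G \<rho> c F e'. x \<le> y) es)"

text \<open>
  \<open>basic_gap G \<rho> c F u k\<close> is the length of the gap between the \<open>k\<close>-th and the \<open>(k+1)\<close>-st interval,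
  for \<open>1 \<le> k \<le> out_degree G u - 1\<close>; since lists are indexed from 0, these are the entries
  \<open>k - 1\<close> and \<open>k\<close>.
\<close>

definition basic_gap ::
  "('a, 'b) pre_digraph \<Rightarrow> ('b \<Rightarrow> real) \<Rightarrow> ('b \<Rightarrow> real) \<Rightarrow> ('a \<Rightarrow> real set) \<Rightarrow> 'a \<Rightarrow> nat \<Rightarrow> real" where
  "basic_gap G \<rho> c F u k =
     Inf (basic_interval G \<rho> c F (ranked_arcs G \<rho> c F u ! k)) -
     Sup (basic_interval G \<rho> c F (ranked_arcs G \<rho> c F u ! (k - 1)))"

definition positive_gaps ::
  "('a, 'b) pre_digraph \<Rightarrow> ('b \<Rightarrow> real) \<Rightarrow> ('b \<Rightarrow> real) \<Rightarrow> ('a \<Rightarrow> real set) \<Rightarrow> 'a \<Rightarrow> real set" where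
  "positive_gaps G \<rho> c F u =
     {basic_gap G \<rho> c F u k | k. k \<in> {1..out_degree G u - 1} \<and> basic_gap G \<rho> c F u k > 0}"


definition rat_powers_nz :: "real set \<Rightarrow> real set" where
  "rat_powers_nz A = {(\<Prod>a\<in>A. a powr of_rat (m a)) | m :: real \<Rightarrow> rat. \<exists>a\<in>A. m a \<noteq> 0}"

definition rat_powers_nonneg_nz :: "real set \<Rightarrow> real set" where
  "rat_powers_nonneg_nz A =
     {(\<Prod>a\<in>A. a powr of_rat (m a)) | m :: real \<Rightarrow> rat. (\<forall>a\<in>A. m a \<ge> 0) \<and> (\<exists>a\<in>A. m a \<noteq> 0)}"

definition rat_powers :: "real set \<Rightarrow> real set" where
  "rat_powers A = {1} \<union> rat_powers_nz A"

definition abs_ratios :: "('b \<Rightarrow> real) \<Rightarrow> 'b set \<Rightarrow> real set" where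
  "abs_ratios \<rho> B = (\<lambda>e. \<bar>\<rho> e\<bar>) ` B"

end

theory Submission
  imports Defs
begin

text \<open>
  A gap of a compact set is a bounded component of its complement. The lengths of the gaps of \<open>F u\<close>
  are the products of a positive basic gap length at some vertex \<open>z\<close> with the absolute ratios along a
  walk from \<open>u\<close> to \<open>z\<close> (\<open>gap_lengths_decompose\<close> and \<open>walk_scales_gap_lengths\<close>). Hypothesis \<open>iii\<close> says
  that the basic gap in such a product is determined by the product up to rational powers of
  contraction ratios.

  Suppose that \<open>F u\<close> is also the attractor of a standard IFS with the COSC, and let \<open>s\<close> be the
  absolute ratio of one of its maps. The map takes gaps to gaps, so from a positive basic gap length
  \<open>\<lambda>\<close> at \<open>u\<close> one obtains gap lengths \<open>s ^ n * \<lambda>\<close> for all \<open>n\<close>. Two of these come from the same basic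
  gap, which makes \<open>s\<close> a rational power product of contraction ratios; then by \<open>iii\<close> the length
  \<open>s * \<lambda>\<close> comes from \<open>\<lambda>\<close>, and \<open>s\<close> is the ratio of a closed walk at \<open>u\<close>
  (\<open>scaling_factor_is_closed_walk_ratio\<close>).

  On the other hand, walking from \<open>u\<close> to \<open>v\<close> and \<open>n\<close> times around the circuit produces gap lengths
  proportional to \<open>R ^ n\<close>, where \<open>R\<close> is the ratio of the circuit. In terms of the standard IFS, each of
  them is a product of ratios of its maps with a number from a finite set
  (\<open>std_ifs_gap_lengths_decompose\<close>). By Dickson's lemma some \<open>R ^ N\<close> with \<open>N > 0\<close> is then itself
  a product of ratios of these maps (\<open>finitely_generated_sequence_quotient\<close>), and so it is the ratio of a
  closed walk \<open>p\<close> at \<open>u\<close>. As \<open>R < 1\<close>, the walk \<open>p\<close> is not empty, and its first arc is not in the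
  circuit because \<open>u\<close> is not. Moving the arcs of \<open>p\<close> that lie in \<open>L\<close> to the other side of the equation
  gives an element of \<open>A(L)\<^sup>\<rat>\<close> that belongs to the set of products over \<open>A(L\<^sup>c)\<close> with nonnegative,
  not all zero, exponents. It is less than 1, so it contradicts hypothesis \<open>i\<close>.
\<close>

section \<open>Gaps of a set of reals\<close>

definition is_gap :: "real set \<Rightarrow> real \<Rightarrow> real \<Rightarrow> bool" where
  "is_gap K a b \<longleftrightarrow> a \<in> K \<and> b \<in> K \<and> a < b \<and> {a<..<b} \<inter> K = {}"

definition gap_lengths :: "real set \<Rightarrow> real set" where
  "gap_lengths K = {b - a | a b. is_gap K a b}"

lemma gap_lengths_pos: "g \<in> gap_lengths K \<Longrightarrow> 0 < g"
  by (auto simp: gap_lengths_def is_gap_def)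

lemma bounded_gap_lengths:
  assumes "bounded B"
  obtains D where "\<And>K g. K \<subseteq> B \<Longrightarrow> g \<in> gap_lengths K \<Longrightarrow> g \<le> D"
proof
  fix K g assume K: "K \<subseteq> B" and "g \<in> gap_lengths K"
  then obtain a b where g: "g = b - a" "a \<in> K" "b \<in> K" "a < b"
    by (auto simp: gap_lengths_def is_gap_def)
  have "dist b a \<le> diameter B"
    using diameter_bounded_bound[OF assms] g K by blast
  then show "g \<le> diameter B"
    using g by (simp add: dist_real_def)
qed

lemma gap_lengths_affine_supset:
  assumes "r \<noteq> 0" "g \<in> gap_lengths K"
  shows "\<bar>r\<bar> * g \<in> gap_lengths (affine_map r c ` K)"
proof -
  obtain a b where ab: "g = b - a" "is_gap K a b"
    using assms(2) by (auto simp: gap_lengths_def)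
  have "is_gap (affine_map r c ` K) (min (affine_map r c a) (affine_map r c b))
      (max (affine_map r c a) (affine_map r c b))"
  proof (cases "r > 0")
    case True
    then show ?thesis
      using ab(2) unfolding is_gap_def affine_map_def
      by (fastforce simp: min_def max_def)
  next
    case False
    then have "r < 0" using assms(1) by simp
    then show ?thesis
      using ab(2) unfolding is_gap_def affine_map_def
      by (fastforce simp: min_def max_def mult_less_cancel_left)
  qed
  moreover have "max (affine_map r c a) (affine_map r c b) - min (affine_map r c a) (affine_map r c b)
      = \<bar>r\<bar> * g"
    unfolding ab(1) affine_map_def using ab(2)
    by (auto simp: max_def min_def abs_if is_gap_def algebra_simps
        mult_le_cancel_left mult_less_cancel_left)
  ultimately show ?thesis
    unfolding gap_lengths_def by force
qed

lemma gap_lengths_affine: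
  assumes "r \<noteq> 0"
  shows "gap_lengths (affine_map r c ` K) = (\<lambda>g. \<bar>r\<bar> * g) ` gap_lengths K"
proof
  show "(\<lambda>g. \<bar>r\<bar> * g) ` gap_lengths K \<subseteq> gap_lengths (affine_map r c ` K)"
    using gap_lengths_affine_supset[OF assms] by blast
  have inv: "affine_map (1 / r) (- c / r) ` affine_map r c ` K = K"
    using assms by (auto simp: image_image affine_map_def field_simps)
  show "gap_lengths (affine_map r c ` K) \<subseteq> (\<lambda>g. \<bar>r\<bar> * g) ` gap_lengths K"
  proof
    fix g assume g: "g \<in> gap_lengths (affine_map r c ` K)"
    have "\<bar>1 / r\<bar> * g \<in> gap_lengths K"
      using gap_lengths_affine_supset[of "1 / r" g _ "- c / r", OF _ g] inv assms by simp
    moreover have "g = \<bar>r\<bar> * (\<bar>1 / r\<bar> * g)"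
      using assms by simp
    ultimately show "g \<in> (\<lambda>g. \<bar>r\<bar> * g) ` gap_lengths K"
      by blast
  qed
qed

section \<open>Affine images and convex hulls on the line\<close>

lemma affine_map_eq_affinity: "affine_map r c = (\<lambda>t. c + r *\<^sub>R t)"
  by (auto simp: affine_map_def)

lemma open_affine_map_image:
  "open S \<Longrightarrow> r \<noteq> 0 \<Longrightarrow> open (affine_map r c ` S)"
  unfolding affine_map_eq_affinity by (rule open_affinity)

lemma convex_affine_map_image:
  "convex S \<Longrightarrow> convex (affine_map r c ` S)"
  unfolding affine_map_eq_affinity by (rule convex_affinity)

lemma affine_map_image_closure:
  "S \<subseteq> closure T \<Longrightarrow> affine_map r c ` S \<subseteq> closure (affine_map r c ` T)"
proof -
  have "affine_map r c ` closure T \<subseteq> closure (affine_map r c ` T)"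
    unfolding affine_map_eq_affinity
    by (intro image_closure_subset continuous_intros closed_closure closure_subset)
  then show "S \<subseteq> closure T \<Longrightarrow> affine_map r c ` S \<subseteq> closure (affine_map r c ` T)"
    by blast
qed

lemma compact_affine_map_image: "compact S \<Longrightarrow> compact (affine_map r c ` S)"
  unfolding affine_map_eq_affinity by (rule compact_affinity)

lemma affine_map_image_convex_hull:
  "affine_map r c ` (convex hull S) = convex hull (affine_map r c ` S)"
  unfolding affine_map_eq_affinity by (rule convex_hull_affinity[symmetric])

lemma compact_Inf_Sup_mem:
  fixes K :: "real set"
  assumes "compact K" "K \<noteq> {}"
  shows "Inf K \<in> K" "Sup K \<in> K" "\<And>x. x \<in> K \<Longrightarrow> Inf K \<le> x" "\<And>x. x \<in> K \<Longrightarrow> x \<le> Sup K"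
proof -
  have bdd: "bdd_below K" "bdd_above K"
    using assms(1) by (auto dest: compact_imp_bounded bounded_imp_bdd_below bounded_imp_bdd_above)
  show "Inf K \<in> K" "Sup K \<in> K"
    using assms bdd compact_imp_closed closed_contains_Inf closed_contains_Sup by blast+
  show "Inf K \<le> x" "x \<le> Sup K" if "x \<in> K" for x
    using bdd that by (auto intro: cInf_lower cSup_upper)
qed

lemma convex_hull_compact_real:
  fixes K :: "real set"
  assumes "compact K" "K \<noteq> {}"
  shows "convex hull K = {Inf K..Sup K}"
proof
  show "convex hull K \<subseteq> {Inf K..Sup K}"
    using compact_Inf_Sup_mem[OF assms] by (intro hull_minimal) auto
  have "closed_segment (Inf K) (Sup K) \<subseteq> convex hull K"
    using compact_Inf_Sup_mem[OF assms] by (intro convex_contains_segment[THEN iffD1, rule_format])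
      (auto intro: hull_inc)
  then show "{Inf K..Sup K} \<subseteq> convex hull K"
    using compact_Inf_Sup_mem[OF assms] by (simp add: closed_segment_eq_real_ivl1)
qed

lemma all_atLeastAtMost_le_iff:
  fixes a b :: real
  assumes "a \<le> b" "a' \<le> b'"
  shows "(\<forall>x\<in>{a..b}. \<forall>y\<in>{a'..b'}. x \<le> y) \<longleftrightarrow> b \<le> a'"
proof
  assume "\<forall>x\<in>{a..b}. \<forall>y\<in>{a'..b'}. x \<le> y"
  from bspec[OF bspec[OF this, of b], of a'] show "b \<le> a'"
    using assms by simp
qed auto

section \<open>Unions of separated pieces\<close>

lemma between_closure_points_subset:
  fixes S :: "real set"
  assumes "convex S" "open S" "a \<in> closure S" "b \<in> closure S"
  shows "{a<..<b} \<subseteq> S"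
proof -
  have "{a..b} \<subseteq> closure S"
    using assms convex_closure[OF assms(1)] by (metis convex_contains_segment
        closed_segment_eq_real_ivl1 atLeastatMost_empty_iff2 empty_subsetI)
  then have "{a<..<b} \<subseteq> interior (closure S)"
    by (intro interior_maximal) auto
  then show ?thesis
    using convex_interior_closure[OF assms(1)] interior_open[OF assms(2)] by simp
qed

text \<open>
  The points of \<open>P i\<close> lie in the closure of the interval \<open>V i\<close>, so a gap of \<open>P i\<close> lies in \<open>V i\<close>
  itself. This open set misses \<open>V j\<close>, hence also the closure of \<open>V j\<close> and the piece \<open>P j\<close>.
\<close>

lemma gap_of_piece:
  fixes P V :: "'i \<Rightarrow> real set"
  assumes disj: "disjoint_family_on V I"
    and cells: "\<And>i. i \<in> I \<Longrightarrow> open (V i) \<and> convex (V i) \<and> P i \<subseteq> closure (V i)"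
    and i: "i \<in> I" "is_gap (P i) a b"
  shows "is_gap (\<Union>i\<in>I. P i) a b"
proof -
  have V: "{a<..<b} \<subseteq> V i"
    using between_closure_points_subset cells[OF i(1)] i(2) by (auto simp: is_gap_def)
  have "{a<..<b} \<inter> P j = {}" if "j \<in> I" for j
  proof (cases "j = i")
    case False
    then have "V i \<inter> V j = {}"
      using disj i(1) that by (auto simp: disjoint_family_on_def)
    then have "V i \<inter> closure (V j) = {}"
      using cells[OF i(1)] by (simp add: open_Int_closure_eq_empty)
    then show ?thesis
      using V cells[OF that] by blast
  qed (use i in \<open>auto simp: is_gap_def\<close>)
  then show ?thesis
    using i by (auto simp: is_gap_def)
qed

lemma gap_within_piece:
  "is_gap K a b \<Longrightarrow> P \<subseteq> K \<Longrightarrow> a \<in> P \<Longrightarrow> b \<in> P \<Longrightarrow> is_gap P a b"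
  by (auto simp: is_gap_def)

text \<open>
  A gap that no single piece sees leads from some piece \<open>P i\<close> to another one \<open>P j\<close>. There is at
  most one for each pair \<open>(i, j)\<close>: two of them would put a point of \<open>P j\<close> strictly between two
  points of \<open>P i\<close>, whereas \<open>V i\<close> and \<open>V j\<close> are disjoint intervals.
\<close>

lemma finite_straddling_gaps:
  fixes P V :: "'i \<Rightarrow> real set"
  assumes fin: "finite I" and disj: "disjoint_family_on V I"
    and cells: "\<And>i. i \<in> I \<Longrightarrow> open (V i) \<and> convex (V i) \<and> P i \<subseteq> closure (V i)"
  shows "finite {b - a | a b. is_gap (\<Union>i\<in>I. P i) a b \<and> \<not> (\<exists>i\<in>I. a \<in> P i \<and> b \<in> P i)}"
proof -
  let ?S = "\<lambda>i j. {(a, b). is_gap (\<Union>i\<in>I. P i) a b \<and> \<not> (\<exists>i\<in>I. a \<in> P i \<and> b \<in> P i) \<and>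
      a \<in> P i \<and> b \<in> P j}"
  \<comment> \<open>applied in both directions, this identifies the left endpoints\<close>
  have order: "a' \<le> a" if ij: "i \<in> I" "j \<in> I" and ab: "(a, b) \<in> ?S i j" "(a', b') \<in> ?S i j"
    for i j a b a' b'
  proof (rule ccontr)
    assume "\<not> a' \<le> a"
    moreover have "a' \<in> (\<Union>i\<in>I. P i)" "{a<..<b} \<inter> (\<Union>i\<in>I. P i) = {}"
      using ab by (auto simp: is_gap_def)
    moreover have "b \<noteq> a'"
      using ab ij by auto
    ultimately have b: "b \<in> {a<..<a'}"
      using ab(1) by (force simp: is_gap_def)
    have "i \<noteq> j"
      using ab ij by auto
    then have "V i \<inter> V j = {}"
      using disj ij by (auto simp: disjoint_family_on_def)
    then have "V i \<inter> closure (V j) = {}"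
      using cells[OF ij(1)] by (simp add: open_Int_closure_eq_empty)
    moreover have "{a<..<a'} \<subseteq> V i"
      using between_closure_points_subset[of "V i" a a'] cells[OF ij(1)] ab by auto
    moreover have "b \<in> closure (V j)"
      using cells[OF ij(2)] ab by auto
    ultimately show False
      using b by blast
  qed
  have "finite (?S i j)" if ij: "i \<in> I" "j \<in> I" for i j
  proof (cases "?S i j = {}")
    case False
    then obtain a b where ab: "(a, b) \<in> ?S i j"
      by auto
    have "?S i j \<subseteq> {(a, b)}"
    proof
      fix p assume p: "p \<in> ?S i j"
      obtain a' b' where [simp]: "p = (a', b')" by (cases p)
      have "a' = a"
        using order[OF ij ab, of a' b'] order[OF ij _ ab, of a' b'] p by (auto intro: antisym)
      moreover have "is_gap (\<Union>i\<in>I. P i) a b'" "is_gap (\<Union>i\<in>I. P i) a b"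
        using p ab calculation by auto
      then have "b' = b"
        unfolding is_gap_def by (smt (verit) disjoint_iff greaterThanLessThan_iff)
      ultimately show "p \<in> {(a, b)}"
        by simp
    qed
    then show ?thesis
      using finite_subset by blast
  qed (use finite.emptyI in metis)
  then have "finite (\<Union>i\<in>I. \<Union>j\<in>I. ?S i j)"
    using fin by blast
  then have "finite ((\<lambda>(a, b). b - a) ` (\<Union>i\<in>I. \<Union>j\<in>I. ?S i j))"
    by blast
  then show ?thesis
    by (rule rev_finite_subset) (force simp: is_gap_def)
qed

section \<open>Attractors and open sets\<close>

text \<open>
  The largest distance from a point of \<open>F w\<close> to \<open>U w\<close>, over all \<open>w\<close>, is attained. The point
  attaining it is the image of a point of some \<open>F z\<close> under a contraction taking \<open>U z\<close> into
  \<open>U w\<close>, so the maximum is at most a proper fraction of itself, and therefore zero. The sets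
  \<open>U w\<close> may be unbounded, as the COSC allows for a standard IFS.
\<close>

lemma attractor_subset_closure:
  fixes F U :: "'i \<Rightarrow> real set"
  assumes fin: "finite X"
    and sets: "\<And>w. w \<in> X \<Longrightarrow> compact (F w) \<and> U w \<noteq> {}"
    and step: "\<And>w y. w \<in> X \<Longrightarrow> y \<in> F w \<Longrightarrow> \<exists>z\<in>X. \<exists>y'\<in>F z. \<exists>r c. contraction_ratio r \<and>
        y = affine_map r c y' \<and> affine_map r c ` U z \<subseteq> U w"
    and w: "w \<in> X"
  shows "F w \<subseteq> closure (U w)"
proof
  fix y assume y: "y \<in> F w"
  define D where "D = (\<Union>w\<in>X. (\<lambda>y. infdist y (U w)) ` F w)"
  have "compact D"
    unfolding D_def using fin sets
    by (intro compact_UN compact_continuous_image continuous_intros) auto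
  moreover have "D \<noteq> {}"
    using y w by (auto simp: D_def)
  ultimately obtain M where M: "M \<in> D" "\<And>d. d \<in> D \<Longrightarrow> d \<le> M"
    using compact_attains_sup by metis
  obtain w0 y0 where w0: "w0 \<in> X" "y0 \<in> F w0" and M_eq: "M = infdist y0 (U w0)"
    using M(1) by (auto simp: D_def)
  obtain z y' r c where z: "z \<in> X" "y' \<in> F z" "contraction_ratio r" "y0 = affine_map r c y'"
    "affine_map r c ` U z \<subseteq> U w0"
    using step[OF w0] by blast
  have r: "0 < \<bar>r\<bar>" "\<bar>r\<bar> < 1"
    using z(3) by (auto simp: contraction_ratio_def)
  have "M / \<bar>r\<bar> \<le> dist y' x" if "x \<in> U z" for x
  proof -
    have "M \<le> dist y0 (affine_map r c x)"
      unfolding M_eq using that z(5) by (intro infdist_le) auto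
    also have "dist y0 (affine_map r c x) = \<bar>r\<bar> * dist y' x"
      unfolding z(4) affine_map_def dist_real_def
      by (simp add: abs_mult[symmetric] right_diff_distrib)
    finally show ?thesis
      using r by (simp add: field_simps)
  qed
  then have "M / \<bar>r\<bar> \<le> infdist y' (U z)"
    using sets[OF z(1)] unfolding infdist_def by (auto intro: cINF_greatest)
  also have "\<dots> \<le> M"
    using z by (intro M(2)) (auto simp: D_def)
  finally have "M * (1 - \<bar>r\<bar>) \<le> 0"
    using r by (simp add: field_simps)
  then have "M \<le> 0"
    using r by (simp add: mult_le_0_iff)
  moreover have "infdist y (U w) \<le> M"
    using y w by (intro M(2)) (auto simp: D_def)
  ultimately have "infdist y (U w) = 0"
    using infdist_nonneg[of y "U w"] by simp
  then show "y \<in> closure (U w)"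
    using sets[OF w] by (simp add: in_closure_iff_infdist_zero)
qed

section \<open>Induction along contractions\<close>

text \<open>
  A gap length is traced back through the maps of an IFS to longer and longer gap lengths. Each step
  gains at least the factor \<open>1 / \<theta>\<close>, so the common bound \<open>D\<close> allows only finitely many steps. The
  index \<open>s\<close> is the vertex whose attractor is considered.
\<close>

lemma contraction_induct:
  fixes \<theta> D :: real
  assumes \<theta>: "0 < \<theta>" "\<theta> < 1"
    and bound: "\<And>s g. g \<in> \<Gamma> s \<Longrightarrow> 0 < g \<and> g \<le> D"
    and g: "g \<in> \<Gamma> s"
    and step: "\<And>s g. g \<in> \<Gamma> s \<Longrightarrow> (\<And>s' g'. g' \<in> \<Gamma> s' \<Longrightarrow> g \<le> \<theta> * g' \<Longrightarrow> Q s' g') \<Longrightarrow> Q s g"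
  shows "Q s g"
proof -
  have main: "g \<in> \<Gamma> s \<Longrightarrow> D * \<theta> ^ n < g \<Longrightarrow> Q s g" for n s g
  proof (induction n arbitrary: s g)
    case 0
    then show ?case
      using bound by fastforce
  next
    case (Suc n)
    show ?case
    proof (rule step[OF Suc.prems(1)])
      fix s' g' assume g': "g' \<in> \<Gamma> s'" "g \<le> \<theta> * g'"
      then have "\<theta> * (D * \<theta> ^ n) < \<theta> * g'"
        using Suc.prems(2) by (simp add: algebra_simps)
      then show "Q s' g'"
        using \<theta> g' by (intro Suc.IH) simp_all
    qed
  qed
  have D: "0 < g" "0 < D"
    using bound[OF g] by auto
  then obtain n where "\<theta> ^ n < g / D"
    using \<theta> real_arch_pow_inv[of "g / D" \<theta>] by auto
  then have "D * \<theta> ^ n < g"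
    using D by (simp add: field_simps)
  then show ?thesis
    using main g by blast
qed

section \<open>Rational powers\<close>

lemma rat_powers_eq:
  assumes "A \<subseteq> {0<..}"
  shows "rat_powers A = {(\<Prod>a\<in>A. a powr of_rat (m a)) | m. True}"
proof
  have "(1::real) = (\<Prod>a\<in>A. a powr of_rat ((\<lambda>_. 0) a))"
    using assms by (intro prod.neutral[symmetric]) auto
  then show "rat_powers A \<subseteq> {(\<Prod>a\<in>A. a powr of_rat (m a)) | m. True}"
    unfolding rat_powers_def rat_powers_nz_def by (auto simp del: of_rat_0)
  show "{(\<Prod>a\<in>A. a powr of_rat (m a)) | m. True} \<subseteq> rat_powers A"
  proof
    fix x assume "x \<in> {(\<Prod>a\<in>A. a powr of_rat (m a)) | m. True}"
    then obtain m where x: "x = (\<Prod>a\<in>A. a powr of_rat (m a))" by blast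
    show "x \<in> rat_powers A"
    proof (cases "\<exists>a\<in>A. m a \<noteq> 0")
      case False
      then have "x = 1"
        unfolding x using assms by (intro prod.neutral) auto
      then show ?thesis by (simp add: rat_powers_def)
    qed (auto simp: x rat_powers_def rat_powers_nz_def)
  qed
qed

lemma rat_powersI:
  "A \<subseteq> {0<..} \<Longrightarrow> x = (\<Prod>a\<in>A. a powr of_rat (m a)) \<Longrightarrow> x \<in> rat_powers A"
  by (auto simp: rat_powers_eq)

lemma one_in_rat_powers: "1 \<in> rat_powers A"
  by (simp add: rat_powers_def)

lemma rat_powers_mult:
  assumes "A \<subseteq> {0<..}" "x \<in> rat_powers A" "y \<in> rat_powers A"
  shows "x * y \<in> rat_powers A"
proof -
  obtain m n where "x = (\<Prod>a\<in>A. a powr of_rat (m a))" "y = (\<Prod>a\<in>A. a powr of_rat (n a))"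
    using assms by (auto simp: rat_powers_eq)
  then have "x * y = (\<Prod>a\<in>A. a powr of_rat (m a + n a))"
    by (simp add: prod.distrib powr_add of_rat_add)
  then show ?thesis
    by (rule rat_powersI[OF assms(1)])
qed

lemma rat_powers_inverse:
  assumes "A \<subseteq> {0<..}" "x \<in> rat_powers A"
  shows "inverse x \<in> rat_powers A"
proof -
  obtain m where "x = (\<Prod>a\<in>A. a powr of_rat (m a))"
    using assms by (auto simp: rat_powers_eq)
  then have "inverse x = (\<Prod>a\<in>A. a powr of_rat (- m a))"
    by (simp add: powr_minus of_rat_minus prod_inversef[symmetric])
  then show ?thesis
    by (rule rat_powersI[OF assms(1)])
qed

lemma rat_powers_divide:
  assumes "A \<subseteq> {0<..}" "x \<in> rat_powers A" "y \<in> rat_powers A"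
  shows "x / y \<in> rat_powers A"
  using rat_powers_mult[OF assms(1,2) rat_powers_inverse[OF assms(1,3)]] by (simp add: divide_inverse)

lemma rat_powers_power:
  assumes "A \<subseteq> {0<..}" "x \<in> rat_powers A"
  shows "x ^ n \<in> rat_powers A"
  by (induction n) (use assms in \<open>simp_all add: rat_powers_mult one_in_rat_powers\<close>)

text \<open>
  This is where rational exponents are needed: integer ones do not survive the extraction of roots.
\<close>

lemma rat_powers_root:
  assumes "A \<subseteq> {0<..}" "0 < x" "0 < n" "x ^ n \<in> rat_powers A"
  shows "x \<in> rat_powers A"
proof -
  obtain m where m: "x ^ n = (\<Prod>a\<in>A. a powr of_rat (m a))"
    using assms by (auto simp: rat_powers_eq)
  have "x = (x ^ n) powr (1 / real n)"
    using assms by (simp add: powr_realpow[symmetric] powr_powr)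
  also have "\<dots> = (\<Prod>a\<in>A. (a powr of_rat (m a)) powr (1 / real n))"
    unfolding m by (rule prod_powr_distrib)
  also have "\<dots> = (\<Prod>a\<in>A. a powr of_rat (m a / of_nat n))"
    by (simp add: powr_powr of_rat_divide)
  finally show ?thesis
    by (rule rat_powersI[OF assms(1)])
qed

lemma generator_eq_prod_powr:
  fixes A :: "real set"
  assumes "finite A" "A \<subseteq> {0<..}" "x \<in> A"
  shows "x = (\<Prod>a\<in>A. a powr of_rat (if a = x then 1 else 0))"
proof -
  have "(\<Prod>a\<in>A. a powr of_rat (if a = x then 1 else 0)) = (\<Prod>a\<in>A. if a = x then x else 1)"
  proof (rule prod.cong)
    fix a assume "a \<in> A"
    then have "0 < a"
      using assms by auto
    then show "a powr of_rat (if a = x then 1 else 0) = (if a = x then x else 1)"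
      by (cases "a = x") auto
  qed simp
  then show ?thesis
    using assms by simp
qed

lemma generator_in_rat_powers:
  assumes "finite A" "A \<subseteq> {0<..}" "x \<in> A"
  shows "x \<in> rat_powers A"
  by (rule rat_powersI[OF assms(2) generator_eq_prod_powr[OF assms]])

lemma generator_in_rat_powers_nonneg_nz:
  assumes "finite A" "A \<subseteq> {0<..}" "x \<in> A"
  shows "x \<in> rat_powers_nonneg_nz A"
  unfolding rat_powers_nonneg_nz_def
  using assms(3) by (intro CollectI exI[of _ "\<lambda>a. if a = x then 1 else 0"] conjI
      generator_eq_prod_powr[OF assms]) auto

lemma rat_powers_nonneg_nz_mult:
  assumes "x \<in> rat_powers_nonneg_nz A" "y \<in> rat_powers_nonneg_nz A"
  shows "x * y \<in> rat_powers_nonneg_nz A"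
proof -
  obtain m n where m: "x = (\<Prod>a\<in>A. a powr of_rat (m a))" "\<forall>a\<in>A. 0 \<le> m a" "\<exists>a\<in>A. m a \<noteq> 0"
    and n: "y = (\<Prod>a\<in>A. a powr of_rat (n a))" "\<forall>a\<in>A. 0 \<le> n a"
    using assms by (auto simp: rat_powers_nonneg_nz_def)
  have "x * y = (\<Prod>a\<in>A. a powr of_rat (m a + n a))"
    using m n by (simp add: prod.distrib powr_add of_rat_add)
  moreover have "\<forall>a\<in>A. 0 \<le> m a + n a" "\<exists>a\<in>A. m a + n a \<noteq> 0"
    using m n by (auto simp: add_nonneg_eq_0_iff)
  ultimately show ?thesis
    unfolding rat_powers_nonneg_nz_def
    by (intro CollectI exI[of _ "\<lambda>a. m a + n a"] conjI)
qed

section \<open>Dickson's lemma\<close>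

text \<open>
  One coordinate at a time: a sequence of natural numbers has a monotone subsequence, and
  a decreasing one is eventually constant.
\<close>

lemma nat_seq_mono_subseq:
  fixes f :: "nat \<Rightarrow> nat"
  obtains s :: "nat \<Rightarrow> nat" where "strict_mono s" "mono (f \<circ> s)"
proof -
  obtain s :: "nat \<Rightarrow> nat" where s: "strict_mono s" "monoseq (\<lambda>n. f (s n))"
    using seq_monosub by blast
  show thesis
  proof (cases "mono (f \<circ> s)")
    case True
    then show ?thesis using s that by blast
  next
    case False
    then have dec: "\<And>m n. m \<le> n \<Longrightarrow> f (s n) \<le> f (s m)"
      using s(2) by (auto simp: monoseq_def mono_def)
    \<comment> \<open>a decreasing sequence is constant from the first index at which it attains its minimum\<close>
    define k where "k = (ARG_MIN (\<lambda>n. f (s n)) n. True)"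
    have k: "f (s k) \<le> f (s n)" for n
      unfolding k_def by (rule arg_min_nat_le) simp
    have "f (s (k + n)) = f (s k)" for n
      using k dec by (intro antisym) auto
    then have "mono (f \<circ> (\<lambda>n. s (k + n)))"
      by (auto simp: mono_def)
    moreover have "strict_mono (\<lambda>n. s (k + n))"
      using s(1) by (auto simp: strict_mono_def)
    ultimately show ?thesis
      using that by blast
  qed
qed

lemma dickson_subseq:
  fixes f :: "nat \<Rightarrow> 'i \<Rightarrow> nat"
  assumes "finite I"
  shows "\<exists>s :: nat \<Rightarrow> nat. strict_mono s \<and> (\<forall>i\<in>I. mono (\<lambda>n. f (s n) i))"
  using assms
proof (induction I rule: finite_induct)
  case empty
  show ?case
    by (intro exI[of _ id]) (auto simp: strict_mono_def)
next
  case (insert j I)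
  then obtain s :: "nat \<Rightarrow> nat" where s: "strict_mono s" "\<forall>i\<in>I. mono (\<lambda>n. f (s n) i)"
    by blast
  obtain t :: "nat \<Rightarrow> nat" where t: "strict_mono t" "mono ((\<lambda>n. f (s n) j) \<circ> t)"
    using nat_seq_mono_subseq .
  have "strict_mono (s \<circ> t)"
    using s(1) t(1) by (rule strict_mono_o)
  moreover have "\<forall>i\<in>insert j I. mono (\<lambda>n. f ((s \<circ> t) n) i)"
    using s(2) t strict_mono_mono[OF t(1)] by (auto simp: mono_def)
  ultimately show ?case
    by blast
qed

section \<open>Gaps of graph-directed attractors\<close>

lemma UN_set_eq_UN_nth: "(\<Union>x\<in>set xs. f x) = (\<Union>i<length xs. f (xs ! i))"
proof -
  have "set xs = (!) xs ` {..<length xs}"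
    by (auto simp: set_conv_nth)
  then show ?thesis
    by simp
qed

abbreviation path_ratio :: "('b \<Rightarrow> real) \<Rightarrow> 'b list \<Rightarrow> real" where
  "path_ratio \<rho> p \<equiv> (\<Prod>e\<leftarrow>p. \<bar>\<rho> e\<bar>)"

text \<open>
  The family \<open>U\<close> is a witness of the COSC, kept as a parameter so that the cells have names. The
  piece of an arc \<open>e\<close> is its contribution to the attractor at the tail of \<open>e\<close>, and its cell is the
  open interval that separates this piece from the others.
\<close>

locale cosc_gd_ifs = fin_digraph G for G :: "('a, 'b) pre_digraph" +
  fixes \<rho> c :: "'b \<Rightarrow> real" and F U :: "'a \<Rightarrow> real set"
  assumes ratio: "e \<in> arcs G \<Longrightarrow> contraction_ratio (\<rho> e)"
    and attractors: "gd_attractors G \<rho> c F"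
    and open_sets: "w \<in> verts G \<Longrightarrow> U w \<noteq> {}" "w \<in> verts G \<Longrightarrow> convex (U w)"
      "w \<in> verts G \<Longrightarrow> open (U w)"
    and images_subset: "w \<in> verts G \<Longrightarrow> e \<in> out_arcs G w \<Longrightarrow>
        affine_map (\<rho> e) (c e) ` U (head G e) \<subseteq> U w"
    and images_disjoint: "w \<in> verts G \<Longrightarrow>
        disjoint_family_on (\<lambda>e. affine_map (\<rho> e) (c e) ` U (head G e)) (out_arcs G w)"
    and deg: "w \<in> verts G \<Longrightarrow> out_degree G w \<ge> 2"
begin

definition piece :: "'b \<Rightarrow> real set" where
  "piece e = affine_map (\<rho> e) (c e) ` F (head G e)"

definition cell :: "'b \<Rightarrow> real set" where
  "cell e = affine_map (\<rho> e) (c e) ` U (head G e)"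

abbreviation lo :: "'b \<Rightarrow> real" where "lo e \<equiv> Inf (piece e)"
abbreviation hi :: "'b \<Rightarrow> real" where "hi e \<equiv> Sup (piece e)"

lemma cell_subset: "w \<in> verts G \<Longrightarrow> e \<in> out_arcs G w \<Longrightarrow> cell e \<subseteq> U w"
  unfolding cell_def by (rule images_subset)

lemma cells_disjoint: "w \<in> verts G \<Longrightarrow> disjoint_family_on cell (out_arcs G w)"
  unfolding cell_def[abs_def] by (rule images_disjoint)

lemma ratio_bounds: "e \<in> arcs G \<Longrightarrow> \<rho> e \<noteq> 0 \<and> 0 < \<bar>\<rho> e\<bar> \<and> \<bar>\<rho> e\<bar> < 1"
  using ratio[of e] by (auto simp: contraction_ratio_def abs_less_iff)

lemma F_compact_nonempty: "w \<in> verts G \<Longrightarrow> compact (F w)" "w \<in> verts G \<Longrightarrow> F w \<noteq> {}"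
  using attractors unfolding gd_attractors_def by blast+

lemma F_eq: "w \<in> verts G \<Longrightarrow> F w = (\<Union>e\<in>out_arcs G w. piece e)"
  unfolding piece_def
  by (rule attractors[unfolded gd_attractors_def, THEN bspec, THEN conjunct2, THEN conjunct2])

lemma piece_subset: "w \<in> verts G \<Longrightarrow> e \<in> out_arcs G w \<Longrightarrow> piece e \<subseteq> F w"
  unfolding F_eq by (rule UN_upper)

lemma F_subset_closure:
  assumes "w \<in> verts G"
  shows "F w \<subseteq> closure (U w)"
proof (rule attractor_subset_closure[OF finite_verts _ _ assms])
  fix w assume "w \<in> verts G"
  then show "compact (F w) \<and> U w \<noteq> {}"
    using F_compact_nonempty open_sets by simp
next
  fix w y assume w: "w \<in> verts G" and "y \<in> F w"
  then obtain e where e: "e \<in> out_arcs G w" "y \<in> piece e"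
    using F_eq[OF w] by blast
  then have "head G e \<in> verts G" "contraction_ratio (\<rho> e)"
    using ratio by auto
  moreover have "cell e \<subseteq> U w"
    using cell_subset[OF w e(1)] .
  ultimately show "\<exists>z\<in>verts G. \<exists>y'\<in>F z. \<exists>r c. contraction_ratio r \<and>
      y = affine_map r c y' \<and> affine_map r c ` U z \<subseteq> U w"
    using e unfolding piece_def cell_def by blast
qed

lemma cell_open_convex:
  assumes "e \<in> arcs G"
  shows "open (cell e) \<and> convex (cell e) \<and> piece e \<subseteq> closure (cell e)"
proof -
  have "head G e \<in> verts G"
    using assms by simp
  then have "open (U (head G e))" "convex (U (head G e))" "F (head G e) \<subseteq> closure (U (head G e))"
    by (simp_all add: open_sets F_subset_closure)
  then show ?thesis
    unfolding cell_def piece_def using ratio_bounds[OF assms]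
    by (intro conjI open_affine_map_image convex_affine_map_image affine_map_image_closure) simp_all
qed

lemma cell_nonempty: "e \<in> arcs G \<Longrightarrow> cell e \<noteq> {}"
  using open_sets(1)[of "head G e"] by (simp add: cell_def)

lemma cell_disjoint_closure:
  assumes "w \<in> verts G" "e \<in> out_arcs G w" "e' \<in> out_arcs G w" "e \<noteq> e'"
  shows "cell e \<inter> closure (cell e') = {}"
proof -
  have "cell e \<inter> cell e' = {}"
    using disjoint_family_onD[OF cells_disjoint[OF assms(1)] assms(2-4)] by simp
  then show ?thesis
    using cell_open_convex[of e] assms by (simp add: open_Int_closure_eq_empty)
qed

lemma two_out_arcs:
  assumes "w \<in> verts G"
  obtains e e' where "e \<in> out_arcs G w" "e' \<in> out_arcs G w" "e \<noteq> e'"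
proof -
  have "2 \<le> card (out_arcs G w)"
    using deg[OF assms] by (simp add: out_degree_def)
  then obtain T where T: "T \<subseteq> out_arcs G w" "card T = 2"
    using obtain_subset_with_card_n by metis
  then obtain e e' where "T = {e, e'}" "e \<noteq> e'"
    by (auto simp: card_2_iff)
  then show thesis
    using T that by blast
qed

lemma piece_nonempty: "e \<in> arcs G \<Longrightarrow> piece e \<noteq> {}"
  using F_compact_nonempty by (simp add: piece_def)

text \<open>
  Two pieces abut at a point only if it lies between two points of \<open>U w\<close>. So if \<open>F w\<close> is the
  single point \<open>p\<close> then \<open>p\<close> belongs to \<open>U w\<close>; but \<open>p\<close> comes from a single point of the same kind
  one step further, which puts \<open>p\<close> into one cell and into the closure of another.
\<close>

lemma singleton_in_open_set:
  assumes w: "w \<in> verts G" "F w = {p}"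
  shows "p \<in> U w"
proof (rule ccontr)
  assume p: "p \<notin> U w"
  obtain e e' where e: "e \<in> out_arcs G w" "e' \<in> out_arcs G w" "e \<noteq> e'"
    using two_out_arcs[OF w(1)] .
  obtain x y where xy: "x \<in> cell e" "y \<in> cell e'"
    using cell_nonempty[of e] cell_nonempty[of e'] e by auto
  have U_xy: "x \<in> U w" "y \<in> U w"
    using xy cell_subset[OF w(1) e(1)] cell_subset[OF w(1) e(2)] by auto
  have "piece e = {p}" "piece e' = {p}"
    using piece_subset[OF w(1) e(1)] piece_subset[OF w(1) e(2)] w(2) e
      piece_nonempty[of e] piece_nonempty[of e'] by auto
  then have cl: "p \<in> closure (cell e)" "p \<in> closure (cell e')"
    using cell_open_convex[of e] cell_open_convex[of e'] e by auto
  have sub: "{a<..<b} \<subseteq> cell f" if "f \<in> {e, e'}" "a \<in> closure (cell f)" "b \<in> closure (cell f)" for a b f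
    using between_closure_points_subset[of "cell f" a b] cell_open_convex[of f] that e by auto
  have disj: "cell e \<inter> cell e' = {}"
    using cell_disjoint_closure[OF w(1) e] closure_subset by blast
  have "{p<..<y} \<subseteq> cell e'" "{y<..<p} \<subseteq> cell e'" "{p<..<x} \<subseteq> cell e" "{x<..<p} \<subseteq> cell e"
    using sub cl xy closure_subset by blast+
  moreover have "x \<noteq> y" "x \<noteq> p" "y \<noteq> p"
    using disj xy p U_xy by auto
  ultimately consider "x < p" "p < y" | "y < p" "p < x"
    using disj xy by (smt (verit) disjoint_iff greaterThanLessThan_iff subset_iff)
  then have "p \<in> {x<..<y} \<union> {y<..<x}"
    by cases auto
  moreover have "{x<..<y} \<subseteq> U w" "{y<..<x} \<subseteq> U w"
    using between_closure_points_subset[OF open_sets(2,3)[OF w(1)]] U_xy closure_subset by auto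
  ultimately show False
    using p by blast
qed

lemma F_not_singleton:
  assumes w: "w \<in> verts G"
  shows "F w \<noteq> {p}"
proof
  assume p: "F w = {p}"
  obtain e e' where e: "e \<in> out_arcs G w" "e' \<in> out_arcs G w" "e \<noteq> e'"
    using two_out_arcs[OF w(1)] .
  have pieces: "piece e = {p}" "piece e' = {p}"
    using piece_subset[OF w e(1)] piece_subset[OF w e(2)] p e
      piece_nonempty[of e] piece_nonempty[of e'] by auto
  have inj: "x = y" if "affine_map (\<rho> e) (c e) x = affine_map (\<rho> e) (c e) y" for x y
    using ratio_bounds[of e] e that by (auto simp: affine_map_def)
  obtain p' where p': "p' \<in> F (head G e)"
    using F_compact_nonempty(2)[of "head G e"] e by auto
  have "affine_map (\<rho> e) (c e) x = p" if "x \<in> F (head G e)" for x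
    using that pieces(1) unfolding piece_def by blast
  then have "F (head G e) = {p'}" "p = affine_map (\<rho> e) (c e) p'"
    using p' inj by auto
  then have "p \<in> cell e"
    using singleton_in_open_set[of "head G e" p'] e by (auto simp: cell_def)
  moreover have "p \<in> closure (cell e')"
    using pieces cell_open_convex[of e'] e by auto
  ultimately show False
    using cell_disjoint_closure[OF w e] by blast
qed

lemma piece_bounds:
  assumes "e \<in> arcs G"
  shows "lo e \<in> piece e" "hi e \<in> piece e" "lo e < hi e" "piece e \<subseteq> {lo e..hi e}"
    "basic_interval G \<rho> c F e = {lo e..hi e}"
proof -
  have h: "head G e \<in> verts G"
    using assms by simp
  have cpt: "compact (piece e)" "piece e \<noteq> {}"
    using F_compact_nonempty[OF h] by (simp_all add: piece_def compact_affine_map_image)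
  note K = compact_Inf_Sup_mem[OF cpt]
  show "lo e \<in> piece e" "hi e \<in> piece e"
    by (fact K)+
  show "piece e \<subseteq> {lo e..hi e}"
    using K(3,4) by auto
  show "basic_interval G \<rho> c F e = {lo e..hi e}"
    unfolding basic_interval_def affine_map_image_convex_hull piece_def[symmetric]
    by (rule convex_hull_compact_real[OF cpt])
  obtain p where p: "p \<in> F (head G e)"
    using F_compact_nonempty(2)[OF h] by blast
  then obtain q where "q \<in> F (head G e)" "q \<noteq> p"
    using F_not_singleton[OF h, of p] by blast
  with p obtain x y where xy: "x \<in> piece e" "y \<in> piece e" "x \<noteq> y"
    using ratio_bounds[OF assms] by (force simp: affine_map_def piece_def)
  show "lo e < hi e"
    using K(3,4)[OF xy(1)] K(3,4)[OF xy(2)] xy(3) by linarith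
qed

text \<open>
  Pieces are nondegenerate and the open intervals that they span lie in disjoint cells.
\<close>

lemma pieces_separated:
  assumes w: "w \<in> verts G" and e: "e \<in> out_arcs G w" "e' \<in> out_arcs G w" "e \<noteq> e'"
  shows "hi e \<le> lo e' \<or> hi e' \<le> lo e"
proof (rule ccontr)
  assume contra: "\<not> (hi e \<le> lo e' \<or> hi e' \<le> lo e)"
  have arcs: "e \<in> arcs G" "e' \<in> arcs G"
    using e by auto
  have sub: "{lo f<..<hi f} \<subseteq> cell f" if "f \<in> arcs G" for f
    using between_closure_points_subset[of "cell f"] cell_open_convex[OF that] piece_bounds[OF that] by blast
  \<comment> \<open>the midpoint of the overlap of the two open intervals\<close>
  define z where "z = (max (lo e) (lo e') + min (hi e) (hi e')) / 2"
  have "max (lo e) (lo e') < min (hi e) (hi e')"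
    using contra piece_bounds(3) arcs by auto
  then have "z \<in> {lo e<..<hi e}" "z \<in> {lo e'<..<hi e'}"
    unfolding z_def by auto
  then have "z \<in> cell e" "z \<in> cell e'"
    using sub arcs by blast+
  then show False
    using cell_disjoint_closure[OF w e] closure_subset by blast
qed

text \<open>
  The arcs leaving \<open>w\<close> are ordered by the left endpoints of their pieces. Nondegeneracy makes
  these endpoints distinct, so that the ranking exists and is unique, and the description in the
  definition of \<open>ranked_arcs\<close> applies to it.
\<close>

lemma ranked_arcs:
  assumes w: "w \<in> verts G"
  defines "es \<equiv> ranked_arcs G \<rho> c F w"
  shows "distinct es" "set es = out_arcs G w" "sorted_wrt (\<lambda>e e'. hi e \<le> lo e') es"
proof -
  let ?R = "\<lambda>e e'. \<forall>x\<in>basic_interval G \<rho> c F e. \<forall>y\<in>basic_interval G \<rho> c F e'. x \<le> y"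
  let ?P = "\<lambda>es. distinct es \<and> set es = out_arcs G w \<and> sorted_wrt ?R es"
  have R: "?R e e' \<longleftrightarrow> hi e \<le> lo e'" if "e \<in> out_arcs G w" "e' \<in> out_arcs G w" for e e'
  proof -
    have arcs: "e \<in> arcs G" "e' \<in> arcs G"
      using that by auto
    then show ?thesis
      using piece_bounds(3)[OF arcs(1)] piece_bounds(3)[OF arcs(2)]
      unfolding piece_bounds(5)[OF arcs(1)] piece_bounds(5)[OF arcs(2)]
      by (intro all_atLeastAtMost_le_iff) simp_all
  qed
  have less: "lo e < lo e'" if "e \<in> out_arcs G w" "hi e \<le> lo e'" for e e'
    using that piece_bounds(3)[of e] by auto
  have inj: "inj_on lo (out_arcs G w)"
  proof (rule inj_onI, rule ccontr)
    fix e e' assume e: "e \<in> out_arcs G w" "e' \<in> out_arcs G w" "lo e = lo e'" "e \<noteq> e'"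
    then show False
      using pieces_separated[OF w e(1,2)] less by fastforce
  qed
  obtain xs where xs: "set xs = out_arcs G w" "distinct xs"
    using finite_distinct_list[OF finite_out_arcs] by blast
  define ys where "ys = sort_key lo xs"
  have ys: "set ys = out_arcs G w" "distinct ys" "sorted (map lo ys)"
    using xs by (auto simp: ys_def)
  have "sorted_wrt (\<lambda>e e'. lo e \<le> lo e' \<and> e \<noteq> e') ys"
    using ys(2,3) by (auto simp: sorted_wrt_iff_nth_less distinct_conv_nth)
  then have "sorted_wrt ?R ys"
  proof (rule sorted_wrt_mono_rel[rotated])
    fix e e' assume e: "e \<in> set ys" "e' \<in> set ys" "lo e \<le> lo e' \<and> e \<noteq> e'"
    then have "hi e \<le> lo e'"
      using pieces_separated[OF w, of e e'] less[of e' e] ys(1) by auto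
    then show "?R e e'"
      using R e ys(1) by blast
  qed
  then have ex: "?P ys"
    using ys by blast
  have unique: "zs = ys" if zs: "?P zs" for zs
  proof -
    have sorted_map: "sorted (map lo zs)" if "?P zs" for zs
      unfolding sorted_map
    proof (rule sorted_wrt_mono_rel)
      show "sorted_wrt ?R zs"
        using that by blast
      fix e e' assume e: "e \<in> set zs" "e' \<in> set zs" "?R e e'"
      then have "hi e \<le> lo e'"
        using R that by blast
      then show "lo e \<le> lo e'"
        using less e that by fastforce
    qed
    have "map lo zs = map lo ys"
      using sorted_map[OF zs] sorted_map[OF ex] zs ex inj
      by (intro sorted_distinct_set_unique) (auto simp: distinct_map)
    then show ?thesis
      using zs ex inj by (intro map_inj_on[of lo]) auto
  qed
  have P: "?P es"
    unfolding es_def ranked_arcs_def by (rule theI[of ?P, OF ex unique])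
  then show "distinct es" "set es = out_arcs G w"
    by blast+
  show "sorted_wrt (\<lambda>e e'. hi e \<le> lo e') es"
    using P R by (auto intro: sorted_wrt_mono_rel[of es ?R])
qed

lemma length_ranked_arcs:
  assumes "w \<in> verts G"
  shows "length (ranked_arcs G \<rho> c F w) = out_degree G w"
  unfolding out_degree_def ranked_arcs(2)[OF assms, symmetric]
  by (rule distinct_card[OF ranked_arcs(1)[OF assms], symmetric])

lemma basic_gap_eq:
  assumes "w \<in> verts G" "k \<in> {1..out_degree G w - 1}"
  shows "basic_gap G \<rho> c F w k =
    lo (ranked_arcs G \<rho> c F w ! k) - hi (ranked_arcs G \<rho> c F w ! (k - 1))"
proof -
  let ?es = "ranked_arcs G \<rho> c F w"
  have "?es ! k \<in> arcs G" "?es ! (k - 1) \<in> arcs G"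
    using ranked_arcs(2)[OF assms(1)] length_ranked_arcs[OF assms(1)] assms(2) nth_mem[of _ ?es]
    by auto
  then show ?thesis
    unfolding basic_gap_def
    using piece_bounds(3)[of "?es ! k"] piece_bounds(3)[of "?es ! (k - 1)"] by (simp add: piece_bounds(5))
qed

text \<open>
  Every piece lies to the left or to the right of a basic gap, according to its rank.
\<close>

lemma positive_basic_gap_in_gap_lengths:
  assumes w: "w \<in> verts G" and k: "k \<in> {1..out_degree G w - 1}"
    and pos: "0 < basic_gap G \<rho> c F w k"
  shows "basic_gap G \<rho> c F w k \<in> gap_lengths (F w)"
proof -
  define es where "es = ranked_arcs G \<rho> c F w"
  note es = ranked_arcs[OF w, folded es_def]
  have len: "length es = out_degree G w"
    using length_ranked_arcs[OF w] by (simp add: es_def)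
  have mem: "es ! i \<in> out_arcs G w" if "i < length es" for i
    using es(2) that nth_mem by blast
  have F: "F w = (\<Union>i<length es. piece (es ! i))"
    unfolding F_eq[OF w] es(2)[symmetric] by (rule UN_set_eq_UN_nth)
  have gap: "basic_gap G \<rho> c F w k = lo (es ! k) - hi (es ! (k - 1))"
    using basic_gap_eq[OF w k] by (simp add: es_def)
  have sorted: "hi (es ! i) \<le> lo (es ! j)" if "i < j" "j < length es" for i j
    using sorted_wrt_nth_less[OF es(3)] that by blast
  have "{hi (es ! (k - 1))<..<lo (es ! k)} \<inter> piece (es ! i) = {}" if i: "i < length es" for i
  proof -
    have b: "piece (es ! i) \<subseteq> {lo (es ! i)..hi (es ! i)}" "lo (es ! i) < hi (es ! i)"
      using piece_bounds[of "es ! i"] mem[OF i] by auto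
    have "i < k - 1 \<or> i = k - 1 \<or> i = k \<or> k < i"
      by linarith
    moreover have "lo (es ! k) < hi (es ! k)" "lo (es ! (k - 1)) < hi (es ! (k - 1))"
      using piece_bounds(3) mem k len by auto
    ultimately have "hi (es ! i) \<le> hi (es ! (k - 1)) \<or> lo (es ! k) \<le> lo (es ! i)"
      using sorted[of i "k - 1"] sorted[of k i] i k len by fastforce
    then show ?thesis
      using b by fastforce
  qed
  moreover have "k < length es" "k - 1 < length es"
    using k len by auto
  then have "hi (es ! (k - 1)) \<in> F w" "lo (es ! k) \<in> F w"
    using piece_bounds(2)[of "es ! (k - 1)"] piece_subset[OF w mem[of "k - 1"]] mem[of "k - 1"]
      piece_bounds(1)[of "es ! k"] piece_subset[OF w mem[of k]] mem[of k] by auto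
  ultimately have "is_gap (F w) (hi (es ! (k - 1))) (lo (es ! k))"
    using pos gap unfolding is_gap_def F by auto
  then show ?thesis
    unfolding gap gap_lengths_def by blast
qed

lemma arc_scales_gap_lengths:
  assumes w: "w \<in> verts G" and e: "e \<in> out_arcs G w" and g: "g \<in> gap_lengths (F (head G e))"
  shows "\<bar>\<rho> e\<bar> * g \<in> gap_lengths (F w)"
proof -
  have "\<bar>\<rho> e\<bar> * g \<in> gap_lengths (piece e)"
    using gap_lengths_affine[of "\<rho> e"] ratio_bounds[of e] e g by (auto simp: piece_def)
  then obtain a b where ab: "\<bar>\<rho> e\<bar> * g = b - a" "is_gap (piece e) a b"
    by (auto simp: gap_lengths_def)
  have "is_gap (F w) a b"
    unfolding F_eq[OF w]
    by (rule gap_of_piece[of cell "out_arcs G w" piece, OF _ _ e ab(2)]) (use cells_disjoint[OF w] cell_open_convex in auto)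
  then show ?thesis
    unfolding ab(1) gap_lengths_def by blast
qed

lemma walk_scales_gap_lengths:
  assumes "awalk w p z" "g \<in> gap_lengths (F z)"
  shows "path_ratio \<rho> p * g \<in> gap_lengths (F w)"
  using assms(1)
proof (induction p arbitrary: w)
  case Nil
  then show ?case using assms(2) by (simp add: awalk_Nil_iff)
next
  case (Cons e p)
  then have "e \<in> out_arcs G w" "w \<in> verts G" "awalk (head G e) p z"
    by (auto simp: awalk_Cons_iff)
  then show ?case
    using arc_scales_gap_lengths[of w e "path_ratio \<rho> p * g"] Cons.IH
    by (simp add: mult.assoc)
qed

text \<open>
  A gap with both endpoints in one piece is the image of a gap one step further along the arc. For any
  other gap the two endpoints belong to pieces of different rank; a nondegenerate piece of
  intermediate rank would meet the gap, so the ranks are consecutive.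
\<close>

lemma gap_lengths_step:
  assumes w: "w \<in> verts G" and g: "g \<in> gap_lengths (F w)"
  shows "(\<exists>e\<in>out_arcs G w. \<exists>g'\<in>gap_lengths (F (head G e)). g = \<bar>\<rho> e\<bar> * g') \<or>
    (\<exists>k\<in>{1..out_degree G w - 1}. g = basic_gap G \<rho> c F w k)"
proof -
  obtain a b where ab: "g = b - a" "is_gap (F w) a b"
    using g by (auto simp: gap_lengths_def)
  show ?thesis
  proof (cases "\<exists>e\<in>out_arcs G w. a \<in> piece e \<and> b \<in> piece e")
    case True
    then obtain e where e: "e \<in> out_arcs G w" "a \<in> piece e" "b \<in> piece e"
      by blast
    then have "is_gap (piece e) a b"
      by (intro gap_within_piece[OF ab(2) piece_subset[OF w]])
    then have "g \<in> gap_lengths (piece e)"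
      unfolding ab(1) gap_lengths_def by blast
    then show ?thesis
      using gap_lengths_affine[of "\<rho> e"] ratio_bounds[of e] e by (auto simp: piece_def)
  next
    case False
    define es where "es = ranked_arcs G \<rho> c F w"
    note es = ranked_arcs[OF w, folded es_def]
    have len: "length es = out_degree G w"
      using length_ranked_arcs[OF w] by (simp add: es_def)
    have mem: "es ! i \<in> out_arcs G w" "es ! i \<in> arcs G" if "i < length es" for i
      using es(2) that nth_mem by fastforce+
    have sorted: "hi (es ! i) \<le> lo (es ! j)" if "i < j" "j < length es" for i j
      using sorted_wrt_nth_less[OF es(3)] that by blast
    have F: "F w = (\<Union>i<length es. piece (es ! i))"
      unfolding F_eq[OF w] es(2)[symmetric] by (rule UN_set_eq_UN_nth)
    have a_lt_b: "a < b" and "a \<in> F w" "b \<in> F w"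
      using ab(2) by (auto simp: is_gap_def)
    have jump: "x \<le> a \<or> b \<le> x" if "x \<in> F w" for x
      using ab(2) that by (auto simp: is_gap_def not_le)
    have inF: "lo (es ! i) \<in> F w" "hi (es ! i) \<in> F w" if "i < length es" for i
      using piece_bounds(1,2) mem[OF that] that unfolding F by blast+
    have bnd: "lo (es ! i) \<le> x" "x \<le> hi (es ! i)" if "i < length es" "x \<in> piece (es ! i)" for i x
      using piece_bounds(4)[OF mem(2)] that by force+
    obtain i j where i: "i < length es" "a \<in> piece (es ! i)" and j: "j < length es" "b \<in> piece (es ! j)"
      using \<open>a \<in> F w\<close> \<open>b \<in> F w\<close> F by auto
    have not_both: "\<not> (a \<in> piece (es ! m) \<and> b \<in> piece (es ! m))" if "m < length es" for m
      using False mem(1)[OF that] by blast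
    have "i \<noteq> j"
      using not_both i j by blast
    moreover have "\<not> j < i"
      using sorted[of j i] bnd[OF i] bnd[OF j] a_lt_b i j by fastforce
    ultimately have "i < j"
      by simp
    have hi: "hi (es ! i) = a"
    proof -
      have "a \<le> hi (es ! i)" "hi (es ! i) \<le> b"
        using bnd[OF i] bnd[OF j] sorted[OF \<open>i < j\<close> j(1)] by auto
      moreover have "hi (es ! i) \<noteq> b"
        using not_both[OF i(1)] i piece_bounds(2)[OF mem(2)[OF i(1)]] by auto
      ultimately show ?thesis
        using jump[OF inF(2)[OF i(1)]] by auto
    qed
    have lo: "lo (es ! j) = b"
    proof -
      have "a \<le> lo (es ! j)" "lo (es ! j) \<le> b"
        using hi bnd[OF j] sorted[OF \<open>i < j\<close> j(1)] by auto
      moreover have "lo (es ! j) \<noteq> a"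
        using not_both[OF j(1)] j piece_bounds(1)[OF mem(2)[OF j(1)]] by auto
      ultimately show ?thesis
        using jump[OF inF(1)[OF j(1)]] by auto
    qed
    have "j = Suc i"
    proof (rule ccontr)
      assume "j \<noteq> Suc i"
      then have m: "Suc i < j" "Suc i < length es"
        using \<open>i < j\<close> j by auto
      note pb = piece_bounds[OF mem(2)[OF m(2)]]
      have "a \<le> lo (es ! Suc i)" "hi (es ! Suc i) \<le> b"
        using sorted[of i "Suc i"] sorted[of "Suc i" j] hi lo m j by auto
      then have "lo (es ! Suc i) = a" "hi (es ! Suc i) = b"
        using pb(3) jump[OF inF(1)[OF m(2)]] jump[OF inF(2)[OF m(2)]] by auto
      then show False
        using not_both[OF m(2)] pb(1,2) by simp
    qed
    then have k: "j \<in> {1..out_degree G w - 1}"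
      using j len by auto
    have "g = basic_gap G \<rho> c F w j"
      using basic_gap_eq[OF w k] hi lo ab(1) \<open>j = Suc i\<close> by (simp add: es_def)
    then show ?thesis
      using k by blast
  qed
qed

text \<open>
  Together with \<open>positive_basic_gap_in_gap_lengths\<close> and \<open>walk_scales_gap_lengths\<close> this describes
  the gap lengths completely.
\<close>

lemma gap_lengths_decompose:
  assumes "w \<in> verts G" "g \<in> gap_lengths (F w)"
  shows "\<exists>p z k. awalk w p z \<and> k \<in> {1..out_degree G z - 1} \<and> 0 < basic_gap G \<rho> c F z k \<and>
    g = path_ratio \<rho> p * basic_gap G \<rho> c F z k"
proof -
  \<comment> \<open>a uniform contraction factor; \<open>1 / 2\<close> keeps the maximum defined and positive without arcs\<close>
  define \<theta> where "\<theta> = Max (insert (1 / 2) ((\<lambda>e. \<bar>\<rho> e\<bar>) ` arcs G))"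
  have \<theta>: "0 < \<theta>" "\<theta> < 1" "\<And>e. e \<in> arcs G \<Longrightarrow> \<bar>\<rho> e\<bar> \<le> \<theta>"
    unfolding \<theta>_def using ratio_bounds by (auto simp: Max_gr_iff)
  have "bounded (\<Union>w\<in>verts G. F w)"
    using F_compact_nonempty(1) by (intro bounded_UN ballI compact_imp_bounded) simp_all
  then obtain D where D: "\<And>K g. K \<subseteq> (\<Union>w\<in>verts G. F w) \<Longrightarrow> g \<in> gap_lengths K \<Longrightarrow> g \<le> D"
    using bounded_gap_lengths by blast
  define \<Gamma> where "\<Gamma> w = (if w \<in> verts G then gap_lengths (F w) else {})" for w
  have \<Gamma>: "g \<in> \<Gamma> w \<longleftrightarrow> w \<in> verts G \<and> g \<in> gap_lengths (F w)" for g w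
    by (simp add: \<Gamma>_def)
  show ?thesis
  proof (rule contraction_induct[of \<theta> \<Gamma> D g w])
    show "0 < g \<and> g \<le> D" if "g \<in> \<Gamma> w" for w g
      using that D[of "F w" g] gap_lengths_pos by (auto simp: \<Gamma>)
  next
    fix w g
    assume g: "g \<in> \<Gamma> w" and
      IH: "\<And>w' g'. g' \<in> \<Gamma> w' \<Longrightarrow> g \<le> \<theta> * g' \<Longrightarrow>
        \<exists>p z k. awalk w' p z \<and> k \<in> {1..out_degree G z - 1} \<and> 0 < basic_gap G \<rho> c F z k \<and>
          g' = path_ratio \<rho> p * basic_gap G \<rho> c F z k"
    then have w: "w \<in> verts G" "g \<in> gap_lengths (F w)"
      by (auto simp: \<Gamma>)
    consider e g' where "e \<in> out_arcs G w" "g' \<in> gap_lengths (F (head G e))" "g = \<bar>\<rho> e\<bar> * g'"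
      | k where "k \<in> {1..out_degree G w - 1}" "g = basic_gap G \<rho> c F w k"
      using gap_lengths_step[OF w] by blast
    then show "\<exists>p z k. awalk w p z \<and> k \<in> {1..out_degree G z - 1} \<and> 0 < basic_gap G \<rho> c F z k \<and>
        g = path_ratio \<rho> p * basic_gap G \<rho> c F z k"
    proof cases
      case 1
      then have "g' \<in> \<Gamma> (head G e)"
        by (auto simp: \<Gamma>)
      moreover have "g \<le> \<theta> * g'"
        using 1 \<theta>(3)[of e] gap_lengths_pos[OF 1(2)] by (auto intro!: mult_right_mono)
      ultimately obtain p z k where pzk: "awalk (head G e) p z" "k \<in> {1..out_degree G z - 1}"
        "0 < basic_gap G \<rho> c F z k" "g' = path_ratio \<rho> p * basic_gap G \<rho> c F z k"
        using IH by blast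
      moreover have "awalk w (e # p) z"
        using 1(1) pzk(1) by (auto simp: awalk_Cons_iff)
      moreover have "g = path_ratio \<rho> (e # p) * basic_gap G \<rho> c F z k"
        using 1(3) pzk(4) by simp
      ultimately show ?thesis
        by blast
    next
      case 2
      then show ?thesis
        using w gap_lengths_pos[OF w(2)]
        by (intro exI[of _ "[]"] exI[of _ w] exI[of _ k]) (auto simp: awalk_Nil_iff)
    qed
  qed (use \<theta> assms in \<open>auto simp: \<Gamma>\<close>)
qed

end

section \<open>Gaps of standard attractors\<close>

text \<open>
  A standard IFS is a set of functions, so the ratio of a member \<open>f\<close> has to be read off from \<open>f\<close>: it
  is \<open>f 1 - f 0\<close>.
\<close>

lemma std_ifs_map:
  assumes "std_ifs \<Phi>" "f \<in> \<Phi>"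
  shows "contraction_ratio (f 1 - f 0)" "f = affine_map (f 1 - f 0) (f 0)"
proof -
  obtain r b where f: "contraction_ratio r" "f = affine_map r b"
    using assms by (auto simp: std_ifs_def)
  then have "f 1 - f 0 = r" "f 0 = b"
    by (simp_all add: affine_map_def)
  then show "contraction_ratio (f 1 - f 0)" "f = affine_map (f 1 - f 0) (f 0)"
    using f by simp_all
qed

lemma std_cosc_cells:
  assumes ifs: "std_ifs \<Phi>" and cosc: "std_cosc \<Phi>" and attr: "std_attractor \<Phi> K"
  obtains V where "disjoint_family_on V \<Phi>"
    "\<And>f. f \<in> \<Phi> \<Longrightarrow> open (V f) \<and> convex (V f) \<and> f ` K \<subseteq> closure (V f)"
proof -
  obtain U where U: "U \<noteq> {}" "convex U" "open U" "(\<Union>f\<in>\<Phi>. f ` U) \<subseteq> U"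
    "disjoint_family_on (\<lambda>f. f ` U) \<Phi>"
    using cosc by (auto simp: std_cosc_def)
  have K: "compact K" "K = (\<Union>f\<in>\<Phi>. f ` K)"
    using attr unfolding std_attractor_def by blast+
  have "K \<subseteq> closure U"
  proof (rule attractor_subset_closure[of "{()}" "\<lambda>_. K" "\<lambda>_. U"])
    fix w :: unit and y assume "y \<in> K"
    then obtain f y' where f: "f \<in> \<Phi>" "y' \<in> K" "y = f y'"
      using K(2) by blast
    have "f ` U \<subseteq> U"
      using U(4) f(1) by blast
    then show "\<exists>z\<in>{()}. \<exists>y'\<in>K. \<exists>r c. contraction_ratio r \<and> y = affine_map r c y' \<and>
        affine_map r c ` U \<subseteq> U"
      using std_ifs_map[OF ifs f(1)] f by (metis singletonI)
  qed (use K U in auto)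
  moreover have "open (f ` U) \<and> convex (f ` U) \<and> f ` K \<subseteq> closure (f ` U)"
    if f: "f \<in> \<Phi>" "K \<subseteq> closure U" for f
  proof -
    have "f 1 - f 0 \<noteq> 0"
      using std_ifs_map(1)[OF ifs f(1)] by (auto simp: contraction_ratio_def)
    then show ?thesis
      using U(2,3) f(2)
      by (subst (1 2 3 4) std_ifs_map(2)[OF ifs f(1)])
        (intro conjI open_affine_map_image convex_affine_map_image affine_map_image_closure)
  qed
  ultimately show thesis
    using that U(5) by blast
qed

lemma std_ifs_scales_gap_lengths:
  assumes ifs: "std_ifs \<Phi>" and cosc: "std_cosc \<Phi>" and attr: "std_attractor \<Phi> K"
    and f: "f \<in> \<Phi>" and g: "g \<in> gap_lengths K"
  shows "\<bar>f 1 - f 0\<bar> * g \<in> gap_lengths K"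
proof -
  obtain V where V: "disjoint_family_on V \<Phi>"
    "\<And>f. f \<in> \<Phi> \<Longrightarrow> open (V f) \<and> convex (V f) \<and> f ` K \<subseteq> closure (V f)"
    using std_cosc_cells[OF ifs cosc attr] by blast
  have K: "K = (\<Union>f\<in>\<Phi>. f ` K)"
    using attr unfolding std_attractor_def by blast
  have r: "f 1 - f 0 \<noteq> 0"
    using std_ifs_map(1)[OF ifs f] by (auto simp: contraction_ratio_def)
  have "\<bar>f 1 - f 0\<bar> * g \<in> gap_lengths (affine_map (f 1 - f 0) (f 0) ` K)"
    using g by (rule gap_lengths_affine_supset[OF r])
  then have "\<bar>f 1 - f 0\<bar> * g \<in> gap_lengths (f ` K)"
    using std_ifs_map(2)[OF ifs f] by simp
  then obtain a b where ab: "\<bar>f 1 - f 0\<bar> * g = b - a" "is_gap (f ` K) a b"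
    by (auto simp: gap_lengths_def)
  have "is_gap (\<Union>f\<in>\<Phi>. f ` K) a b"
    by (rule gap_of_piece[of V \<Phi> "\<lambda>f. f ` K", OF V f ab(2)])
  then show ?thesis
    unfolding ab(1) gap_lengths_def K[symmetric] by blast
qed

text \<open>
  Tracing a gap back through the maps of the IFS ends at a gap that straddles two of the sets \<open>f ` K\<close>,
  and these are finite in number. Only the multiplicity \<open>a f\<close> of each map is recorded; the
  order of the maps does not affect the length.
\<close>

lemma std_ifs_gap_lengths_decompose:
  assumes ifs: "std_ifs \<Phi>" and cosc: "std_cosc \<Phi>" and attr: "std_attractor \<Phi> K"
  shows "\<exists>B. finite B \<and> (\<forall>g\<in>gap_lengths K. \<exists>b\<in>B. \<exists>a :: (real \<Rightarrow> real) \<Rightarrow> nat.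
    g = b * (\<Prod>f\<in>\<Phi>. \<bar>f 1 - f 0\<bar> ^ a f))"
proof -
  obtain V where V: "disjoint_family_on V \<Phi>"
    "\<And>f. f \<in> \<Phi> \<Longrightarrow> open (V f) \<and> convex (V f) \<and> f ` K \<subseteq> closure (V f)"
    using std_cosc_cells[OF ifs cosc attr] by blast
  have K: "compact K" "K = (\<Union>f\<in>\<Phi>. f ` K)"
    using attr unfolding std_attractor_def by blast+
  have fin: "finite \<Phi>"
    using ifs by (simp add: std_ifs_def)
  have ratio: "f 1 - f 0 \<noteq> 0" "\<bar>f 1 - f 0\<bar> < 1" if "f \<in> \<Phi>" for f
    using std_ifs_map(1)[OF ifs that] by (auto simp: contraction_ratio_def abs_less_iff)
  define B where "B = {b - a | a b. is_gap (\<Union>f\<in>\<Phi>. f ` K) a b \<and> \<not> (\<exists>f\<in>\<Phi>. a \<in> f ` K \<and> b \<in> f ` K)}"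
  have "finite B"
    unfolding B_def by (rule finite_straddling_gaps[OF fin V(1)]) (rule V(2))
  \<comment> \<open>as before, \<open>1 / 2\<close> covers the case of an empty family\<close>
  define \<theta> where "\<theta> = Max (insert (1 / 2) ((\<lambda>f. \<bar>f 1 - f 0\<bar>) ` \<Phi>))"
  have \<theta>: "0 < \<theta>" "\<theta> < 1" "\<And>f. f \<in> \<Phi> \<Longrightarrow> \<bar>f 1 - f 0\<bar> \<le> \<theta>"
    unfolding \<theta>_def using fin ratio by (auto simp: Max_gr_iff)
  obtain D where D: "\<And>K' g. K' \<subseteq> K \<Longrightarrow> g \<in> gap_lengths K' \<Longrightarrow> g \<le> D"
    using bounded_gap_lengths[OF compact_imp_bounded[OF K(1)]] by blast
  have "\<exists>b\<in>B. \<exists>a :: (real \<Rightarrow> real) \<Rightarrow> nat. g = b * (\<Prod>f\<in>\<Phi>. \<bar>f 1 - f 0\<bar> ^ a f)"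
    if "g \<in> gap_lengths K" for g
  proof (rule contraction_induct[of \<theta> "\<lambda>_. gap_lengths K" D g "()"])
    show "0 < g \<and> g \<le> D" if "g \<in> gap_lengths K" for g
      using that D[of K g] gap_lengths_pos by auto
  next
    fix g
    assume g: "g \<in> gap_lengths K" and
      IH: "\<And>(s :: unit) g'. g' \<in> gap_lengths K \<Longrightarrow> g \<le> \<theta> * g' \<Longrightarrow>
        \<exists>b\<in>B. \<exists>a :: (real \<Rightarrow> real) \<Rightarrow> nat. g' = b * (\<Prod>f\<in>\<Phi>. \<bar>f 1 - f 0\<bar> ^ a f)"
    obtain x y where xy: "g = y - x" "is_gap K x y"
      using g by (auto simp: gap_lengths_def)
    show "\<exists>b\<in>B. \<exists>a :: (real \<Rightarrow> real) \<Rightarrow> nat. g = b * (\<Prod>f\<in>\<Phi>. \<bar>f 1 - f 0\<bar> ^ a f)"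
    proof (cases "\<exists>f\<in>\<Phi>. x \<in> f ` K \<and> y \<in> f ` K")
      case True
      then obtain h where h: "h \<in> \<Phi>" "x \<in> h ` K" "y \<in> h ` K"
        by blast
      have "h ` K \<subseteq> K"
        using K(2) h(1) by blast
      then have "is_gap (h ` K) x y"
        using gap_within_piece[OF xy(2) _ h(2,3)] by blast
      then have "g \<in> gap_lengths (affine_map (h 1 - h 0) (h 0) ` K)"
        using xy(1) std_ifs_map(2)[OF ifs h(1)] unfolding gap_lengths_def by auto
      then obtain g' where g': "g' \<in> gap_lengths K" "g = \<bar>h 1 - h 0\<bar> * g'"
        unfolding gap_lengths_affine[OF ratio(1)[OF h(1)]] by blast
      have "g \<le> \<theta> * g'"
        unfolding g'(2) using \<theta>(3)[OF h(1)] gap_lengths_pos[OF g'(1)] by (auto intro: mult_right_mono)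
      then obtain b a where b: "b \<in> B" "g' = b * (\<Prod>f\<in>\<Phi>. \<bar>f 1 - f 0\<bar> ^ a f)"
        using IH[OF g'(1)] by blast
      define a' where "a' = a(h := Suc (a h))"
      have "(\<Prod>f\<in>\<Phi>. \<bar>f 1 - f 0\<bar> ^ a' f) =
          \<bar>h 1 - h 0\<bar> ^ a' h * (\<Prod>f\<in>\<Phi> - {h}. \<bar>f 1 - f 0\<bar> ^ a' f)"
        using fin h(1) by (rule prod.remove)
      also have "(\<Prod>f\<in>\<Phi> - {h}. \<bar>f 1 - f 0\<bar> ^ a' f) = (\<Prod>f\<in>\<Phi> - {h}. \<bar>f 1 - f 0\<bar> ^ a f)"
        by (intro prod.cong) (auto simp: a'_def)
      also have "\<bar>h 1 - h 0\<bar> ^ a' h * \<dots> =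
          \<bar>h 1 - h 0\<bar> * (\<bar>h 1 - h 0\<bar> ^ a h * (\<Prod>f\<in>\<Phi> - {h}. \<bar>f 1 - f 0\<bar> ^ a f))"
        by (simp add: a'_def)
      also have "\<bar>h 1 - h 0\<bar> ^ a h * (\<Prod>f\<in>\<Phi> - {h}. \<bar>f 1 - f 0\<bar> ^ a f) =
          (\<Prod>f\<in>\<Phi>. \<bar>f 1 - f 0\<bar> ^ a f)"
        using prod.remove[OF fin h(1), of "\<lambda>f. \<bar>f 1 - f 0\<bar> ^ a f"] by simp
      finally have "g = b * (\<Prod>f\<in>\<Phi>. \<bar>f 1 - f 0\<bar> ^ a' f)"
        using g'(2) b(2) by (simp add: mult_ac)
      then show ?thesis
        using b(1) by blast
    next
      case False
      then have "g \<in> B"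
        using xy unfolding B_def K(2)[symmetric] by blast
      then show ?thesis
        by (intro bexI[of _ g] exI[of _ "\<lambda>_. 0"]) simp_all
    qed
  qed (use \<theta> that in auto)
  then show ?thesis
    using \<open>finite B\<close> by blast
qed

section \<open>Ratios of closed walks\<close>

lemma path_ratio_in_rat_powers:
  assumes "finite E" "\<And>e. e \<in> E \<Longrightarrow> \<rho> e \<noteq> 0" "set p \<subseteq> E"
  shows "path_ratio \<rho> p \<in> rat_powers (abs_ratios \<rho> E)"
  using assms(3)
proof (induction p)
  case (Cons e p)
  have A: "finite (abs_ratios \<rho> E)" "abs_ratios \<rho> E \<subseteq> {0<..}"
    using assms by (auto simp: abs_ratios_def)
  have "\<bar>\<rho> e\<bar> \<in> rat_powers (abs_ratios \<rho> E)"
    using Cons.prems by (intro generator_in_rat_powers[OF A]) (auto simp: abs_ratios_def)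
  then show ?case
    using Cons rat_powers_mult[OF A(2)] by simp
qed (simp add: one_in_rat_powers)

lemma path_ratio_in_rat_powers_nonneg_nz:
  assumes "finite E" "\<And>e. e \<in> E \<Longrightarrow> \<rho> e \<noteq> 0" "set p \<subseteq> E" "p \<noteq> []"
  shows "path_ratio \<rho> p \<in> rat_powers_nonneg_nz (abs_ratios \<rho> E)"
  using assms(4,3)
proof (induction p rule: list_nonempty_induct)
  case (single e)
  then show ?case
    using assms by (auto intro!: generator_in_rat_powers_nonneg_nz simp: abs_ratios_def)
next
  case (cons e p)
  have "\<bar>\<rho> e\<bar> \<in> rat_powers_nonneg_nz (abs_ratios \<rho> E)"
    using assms cons.prems by (intro generator_in_rat_powers_nonneg_nz) (auto simp: abs_ratios_def)
  then show ?case
    using cons rat_powers_nonneg_nz_mult by simp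
qed

lemma path_ratio_filter:
  "path_ratio \<rho> p = path_ratio \<rho> (filter P p) * path_ratio \<rho> (filter (\<lambda>e. \<not> P e) p)"
  by (induction p) auto

context cosc_gd_ifs
begin

lemma path_ratio_pos: "set p \<subseteq> arcs G \<Longrightarrow> 0 < path_ratio \<rho> p"
  by (induction p) (auto dest: ratio_bounds)

lemma path_ratio_le_1: "set p \<subseteq> arcs G \<Longrightarrow> path_ratio \<rho> p \<le> 1"
proof (induction p)
  case (Cons e p)
  then show ?case
    using ratio_bounds[of e] path_ratio_pos[of p] by (auto intro: mult_le_one)
qed simp

lemma path_ratio_less_1:
  assumes "set p \<subseteq> arcs G" "p \<noteq> []"
  shows "path_ratio \<rho> p < 1"
proof -
  obtain e q where p: "p = e # q"
    using assms(2) by (cases p) auto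
  have "\<bar>\<rho> e\<bar> * path_ratio \<rho> q \<le> \<bar>\<rho> e\<bar> * 1"
    using path_ratio_le_1[of q] assms p by (intro mult_left_mono) auto
  also have "\<dots> < 1"
    using ratio_bounds[of e] assms p by simp
  finally show ?thesis
    using p by simp
qed

lemma awalk_set: "awalk w p z \<Longrightarrow> set p \<subseteq> arcs G"
  by auto

lemma closed_walk_ratio_power:
  assumes "awalk w p w"
  shows "\<exists>q. awalk w q w \<and> path_ratio \<rho> p ^ n = path_ratio \<rho> q"
proof (induction n)
  case 0
  then show ?case
    using assms by (intro exI[of _ "[]"]) (auto simp: awalk_Nil_iff)
next
  case (Suc n)
  then obtain q where q: "awalk w q w" "path_ratio \<rho> p ^ n = path_ratio \<rho> q"
    by blast
  then show ?case
    using awalk_appendI[OF assms q(1)] by (intro exI[of _ "p @ q"]) (simp del: awalk_append_iff)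
qed

lemma closed_walk_ratio_prod:
  assumes "w \<in> verts G" "finite I" "\<And>i. i \<in> I \<Longrightarrow> \<exists>p. awalk w p w \<and> x i = path_ratio \<rho> p"
  shows "\<exists>q. awalk w q w \<and> (\<Prod>i\<in>I. x i ^ d i) = path_ratio \<rho> q"
  using assms(2,3)
proof (induction I rule: finite_induct)
  case empty
  then show ?case
    using assms(1) by (intro exI[of _ "[]"]) (auto simp: awalk_Nil_iff)
next
  case (insert i I)
  obtain q where q: "awalk w q w" "(\<Prod>i\<in>I. x i ^ d i) = path_ratio \<rho> q"
    using insert by blast
  obtain p where "awalk w p w" "x i = path_ratio \<rho> p"
    using insert.prems by blast
  then obtain p' where p': "awalk w p' w" "x i ^ d i = path_ratio \<rho> p'"
    using closed_walk_ratio_power by metis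
  show ?case
    using awalk_appendI[OF p'(1) q(1)] p'(2) q(2) insert.hyps
    by (intro exI[of _ "p' @ q"]) (simp del: awalk_append_iff)
qed

text \<open>
  The gap lengths \<open>s ^ n * \<lambda>\<close>, where \<open>\<lambda>\<close> is a basic gap length at \<open>u\<close>, come from finitely many basic
  gaps, so two of them come from the same one. Their quotient is a quotient of path ratios, and
  taking a root shows that \<open>s\<close> is a rational power product of contraction ratios. By \<open>indep\<close> the
  length \<open>s * \<lambda>\<close> must then come from \<open>\<lambda>\<close> itself, along a walk from \<open>u\<close> back to \<open>u\<close>.
\<close>

lemma scaling_factor_is_closed_walk_ratio:
  assumes u: "u \<in> verts G" and k0: "k0 \<in> {1..out_degree G u - 1}" "0 < basic_gap G \<rho> c F u k0"
    and indep: "\<And>z k. z \<in> verts G \<Longrightarrow> k \<in> {1..out_degree G z - 1} \<Longrightarrow> (z, k) \<noteq> (u, k0) \<Longrightarrow>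
        basic_gap G \<rho> c F z k / basic_gap G \<rho> c F u k0 \<notin> rat_powers (abs_ratios \<rho> (arcs G))"
    and s: "0 < s" "\<And>n. s ^ n * basic_gap G \<rho> c F u k0 \<in> gap_lengths (F u)"
  shows "\<exists>p. awalk u p u \<and> s = path_ratio \<rho> p"
proof -
  let ?l = "basic_gap G \<rho> c F"
  let ?Q = "rat_powers (abs_ratios \<rho> (arcs G))"
  have A: "abs_ratios \<rho> (arcs G) \<subseteq> {0<..}"
    using ratio_bounds by (auto simp: abs_ratios_def)
  have "\<exists>p z k. awalk u p z \<and> k \<in> {1..out_degree G z - 1} \<and> 0 < ?l z k \<and>
      s ^ n * ?l u k0 = path_ratio \<rho> p * ?l z k" for n
    using gap_lengths_decompose[OF u s(2)] .
  then obtain p z k where pzk: "\<And>n. awalk u (p n) (z n)" "\<And>n. k n \<in> {1..out_degree G (z n) - 1}"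
    "\<And>n. 0 < ?l (z n) (k n)" "\<And>n. s ^ n * ?l u k0 = path_ratio \<rho> (p n) * ?l (z n) (k n)"
    by metis
  have pos: "0 < path_ratio \<rho> (p n)" for n
    using path_ratio_pos awalk_set[OF pzk(1)] by blast
  have Q: "path_ratio \<rho> (p n) \<in> ?Q" for n
    using awalk_set[OF pzk(1)] ratio_bounds by (intro path_ratio_in_rat_powers) auto
  have z: "z n \<in> verts G" for n
    using pzk(1) by blast
  have "range (\<lambda>n. (z n, k n)) \<subseteq> (SIGMA w:verts G. {1..out_degree G w - 1})"
    using z pzk(2) by auto
  then have "finite (range (\<lambda>n. (z n, k n)))"
    by (rule finite_subset) simp
  then have "\<not> inj (\<lambda>n. (z n, k n))"
    using range_inj_infinite by blast
  then obtain m n where mn: "m < n" "z m = z n" "k m = k n"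
    by (auto simp: inj_def) (metis linorder_neqE_nat)
  have "s ^ (n - m) = path_ratio \<rho> (p n) / path_ratio \<rho> (p m)"
  proof -
    have "s ^ n = s ^ m * s ^ (n - m)"
      using mn(1) by (simp flip: power_add)
    then have "path_ratio \<rho> (p n) * ?l (z n) (k n) = s ^ m * ?l u k0 * s ^ (n - m)"
      using pzk(4)[of n] by (simp add: mult_ac)
    also have "\<dots> = path_ratio \<rho> (p m) * s ^ (n - m) * ?l (z n) (k n)"
      using pzk(4)[of m] mn by (simp add: mult_ac)
    finally show ?thesis
      using pzk(3)[of n] pos[of m] by (simp add: field_simps)
  qed
  also have "\<dots> \<in> ?Q"
    by (intro rat_powers_divide A Q)
  finally have "s \<in> ?Q"
    using mn(1) s(1) by (intro rat_powers_root[OF A, of s "n - m"]) auto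
  then have "s / path_ratio \<rho> (p 1) \<in> ?Q"
    by (intro rat_powers_divide A Q)
  also have "s / path_ratio \<rho> (p 1) = ?l (z 1) (k 1) / ?l u k0"
    using pzk(4)[of 1] pos[of 1] k0(2) by (simp add: field_simps)
  finally have "(z 1, k 1) = (u, k0)"
    using indep[OF z pzk(2)] by blast
  then show ?thesis
    using pzk(1,4)[of 1] k0(2) by auto
qed

end

section \<open>The circuit and the closed walks at a vertex outside it\<close>

text \<open>
  After passing to a subsequence the factor from \<open>B\<close> is constant, by the pigeonhole principle, and
  all exponents increase, by Dickson's lemma. Then two terms differ only by the additional powers.
\<close>

lemma finitely_generated_sequence_quotient:
  fixes g :: "nat \<Rightarrow> real" and x :: "'i \<Rightarrow> real"
  assumes "finite B" "finite I"
    and g: "\<And>n. \<exists>b\<in>B. \<exists>a :: 'i \<Rightarrow> nat. g n = b * (\<Prod>i\<in>I. x i ^ a i)"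
  shows "\<exists>m n. \<exists>d :: 'i \<Rightarrow> nat. m < n \<and> g n = g m * (\<Prod>i\<in>I. x i ^ d i)"
proof -
  obtain b a where ba: "\<And>n. b n \<in> B" "\<And>n. g n = b n * (\<Prod>i\<in>I. x i ^ (a n i :: nat))"
    using g by metis
  have "finite (range b)"
    using ba(1) by (intro finite_subset[OF _ assms(1)]) auto
  then obtain n0 where inf: "infinite {n. b n = b n0}"
    using pigeonhole_infinite[of UNIV b] by auto
  define t where "t = enumerate {n. b n = b n0}"
  have t: "strict_mono t" "\<And>n. b (t n) = b n0"
    using strict_mono_enumerate[OF inf] enumerate_in_set[OF inf] by (auto simp: t_def)
  obtain s :: "nat \<Rightarrow> nat" where s: "strict_mono s" "\<forall>i\<in>I. mono (\<lambda>n. a (t (s n)) i)"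
    using dickson_subseq[OF assms(2), of "\<lambda>n. a (t n)"] by blast
  define m n where "m = t (s 0)" and "n = t (s 1)"
  have "m < n"
    using s(1) t(1) by (simp add: m_def n_def strict_mono_less)
  have le: "a m i \<le> a n i" if "i \<in> I" for i
    using s(2) that by (auto simp: m_def n_def dest!: bspec monoD[of _ 0 1])
  have "(\<Prod>i\<in>I. x i ^ a n i) = (\<Prod>i\<in>I. x i ^ a m i * x i ^ (a n i - a m i))"
    using le by (intro prod.cong) (auto simp flip: power_add)
  then have "g n = g m * (\<Prod>i\<in>I. x i ^ (a n i - a m i))"
    using ba(2) t(2) by (simp add: m_def n_def prod.distrib)
  with \<open>m < n\<close> show ?thesis
    by (intro exI conjI)
qed

theorem lemma4p1:
  fixes G :: "('a, 'b) pre_digraph"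
    and \<rho> c :: "'b \<Rightarrow> real"
    and F :: "'a \<Rightarrow> real set"
    and L :: "'b list"
    and x u v :: 'a
  assumes digraph: "fin_digraph G"
    and deg: "\<And>w. w \<in> verts G \<Longrightarrow> out_degree G w \<ge> 2"
    and circuit: "pre_digraph.awalk G x L x" "L \<noteq> []"
    and not_all: "set (pre_digraph.awalk_verts G x L) \<noteq> verts G"
    and u: "u \<in> verts G" "u \<notin> set (pre_digraph.awalk_verts G x L)"
    and v: "v \<in> set (pre_digraph.awalk_verts G x L)"
    and path: "\<exists>p. p \<noteq> [] \<and> pre_digraph.awalk G u p v"
    and ifs: "gd_ifs G \<rho> c"
    and cosc: "gd_cosc G \<rho> c"
    and attractors: "gd_attractors G \<rho> c F"
    and i: "rat_powers_nz (abs_ratios \<rho> (set L)) \<inter>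
            rat_powers_nonneg_nz (abs_ratios \<rho> (arcs G - set L)) = {}"
    and ii: "positive_gaps G \<rho> c F u \<noteq> {}" "positive_gaps G \<rho> c F v \<noteq> {}"
    and iii: "\<And>w z k m. \<lbrakk>w \<in> verts G; z \<in> verts G; (w, k) \<noteq> (z, m);
                k \<in> {1..out_degree G w - 1}; m \<in> {1..out_degree G z - 1};
                basic_gap G \<rho> c F z m \<noteq> 0\<rbrakk> \<Longrightarrow>
              basic_gap G \<rho> c F w k / basic_gap G \<rho> c F z m \<notin>
                rat_powers (abs_ratios \<rho> (set L) \<union> abs_ratios \<rho> (arcs G - set L))"
  shows "\<not> (\<exists>\<Phi>. std_ifs \<Phi> \<and> std_cosc \<Phi> \<and> std_attractor \<Phi> (F u))"
proof
  assume "\<exists>\<Phi>. std_ifs \<Phi> \<and> std_cosc \<Phi> \<and> std_attractor \<Phi> (F u)"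
  then obtain \<Phi> where \<Phi>: "std_ifs \<Phi>" "std_cosc \<Phi>" "std_attractor \<Phi> (F u)"
    by blast
  obtain U :: "'a \<Rightarrow> real set" where U: "\<forall>w\<in>verts G. U w \<noteq> {} \<and> bounded (U w) \<and> convex (U w) \<and> open (U w) \<and>
        (\<Union>e\<in>out_arcs G w. affine_map (\<rho> e) (c e) ` U (head G e)) \<subseteq> U w \<and>
        disjoint_family_on (\<lambda>e. affine_map (\<rho> e) (c e) ` U (head G e)) (out_arcs G w)"
    using cosc unfolding gd_cosc_def by blast
  interpret fin_digraph G
    by (rule digraph)
  interpret cosc_gd_ifs G \<rho> c F U
  proof
    show "e \<in> arcs G \<Longrightarrow> contraction_ratio (\<rho> e)" for e
      using ifs by (simp add: gd_ifs_def)
    show "affine_map (\<rho> e) (c e) ` U (head G e) \<subseteq> U w" if "w \<in> verts G" "e \<in> out_arcs G w" for w e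
      using bspec[OF U that(1)] that(2) by blast
  qed (use U deg attractors in blast)+
  have L_arcs: "set L \<subseteq> arcs G"
    using awalk_set[OF circuit(1)] .
  have "abs_ratios \<rho> (set L) \<union> abs_ratios \<rho> (arcs G - set L) = abs_ratios \<rho> (arcs G)"
    unfolding abs_ratios_def using L_arcs by (simp add: image_Un[symmetric] Un_absorb1)
  note indep = iii[unfolded this]
  obtain k0 where k0: "k0 \<in> {1..out_degree G u - 1}" "0 < basic_gap G \<rho> c F u k0"
    using ii(1) by (auto simp: positive_gaps_def)
  obtain kv where kv: "kv \<in> {1..out_degree G v - 1}" "0 < basic_gap G \<rho> c F v kv"
    using ii(2) by (auto simp: positive_gaps_def)
  have closed: "\<exists>p. awalk u p u \<and> \<bar>f 1 - f 0\<bar> = path_ratio \<rho> p" if f: "f \<in> \<Phi>" for f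
  proof (rule scaling_factor_is_closed_walk_ratio[OF u(1) k0])
    show "0 < \<bar>f 1 - f 0\<bar>"
      using std_ifs_map(1)[OF \<Phi>(1) f] by (auto simp: contraction_ratio_def)
    show "\<bar>f 1 - f 0\<bar> ^ n * basic_gap G \<rho> c F u k0 \<in> gap_lengths (F u)" for n
    proof (induction n)
      case 0
      show ?case
        using positive_basic_gap_in_gap_lengths[OF u(1) k0] by simp
    next
      case (Suc n)
      then show ?case
        using std_ifs_scales_gap_lengths[OF \<Phi> f] by (simp add: mult.assoc)
    qed
  qed (use indep u(1) k0 in simp)
  \<comment> \<open>gaps of \<open>F u\<close>: go to \<open>v\<close>, around the circuit \<open>n\<close> times, and take a basic gap at \<open>v\<close>\<close>
  obtain q where q: "awalk u q v"
    using path by blast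
  obtain L1 L2 where L12: "L = L1 @ L2" "awalk x L1 v" "awalk v L2 x"
    using awalk_decomp[OF circuit(1) v] by blast
  have loop: "awalk v (L2 @ L1) v"
    using awalk_appendI[OF L12(3,2)] .
  have loop_ratio: "path_ratio \<rho> (L2 @ L1) = path_ratio \<rho> L"
    by (simp add: L12(1))
  let ?g = "\<lambda>n. path_ratio \<rho> q * (path_ratio \<rho> L ^ n * basic_gap G \<rho> c F v kv)"
  have gaps: "?g n \<in> gap_lengths (F u)" for n
  proof -
    obtain p where "awalk v p v" "path_ratio \<rho> L ^ n = path_ratio \<rho> p"
      using closed_walk_ratio_power[OF loop] loop_ratio by metis
    then show ?thesis
      using positive_basic_gap_in_gap_lengths[OF _ kv] walk_scales_gap_lengths q
      by (metis awalk_last_in_verts)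
  qed
  obtain B where B: "finite B" "\<forall>g\<in>gap_lengths (F u).
      \<exists>b\<in>B. \<exists>a :: (real \<Rightarrow> real) \<Rightarrow> nat. g = b * (\<Prod>f\<in>\<Phi>. \<bar>f 1 - f 0\<bar> ^ a f)"
    using std_ifs_gap_lengths_decompose[OF \<Phi>] by blast
  have fin: "finite \<Phi>"
    using \<Phi>(1) by (simp add: std_ifs_def)
  obtain m n and d :: "(real \<Rightarrow> real) \<Rightarrow> nat"
    where mn: "m < n" "?g n = ?g m * (\<Prod>f\<in>\<Phi>. \<bar>f 1 - f 0\<bar> ^ d f)"
    using finitely_generated_sequence_quotient[OF B(1) fin bspec[OF B(2) gaps]] by blast
  have L_pos: "0 < path_ratio \<rho> L" and q_pos: "0 < path_ratio \<rho> q"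
    using path_ratio_pos L_arcs awalk_set[OF q] by blast+
  have "path_ratio \<rho> L ^ n = path_ratio \<rho> L ^ m * path_ratio \<rho> L ^ (n - m)"
    using mn(1) by (simp flip: power_add)
  then have L_eq: "path_ratio \<rho> L ^ (n - m) = (\<Prod>f\<in>\<Phi>. \<bar>f 1 - f 0\<bar> ^ d f)"
    using mn(2) L_pos q_pos kv(2) by simp
  obtain p where p: "awalk u p u" "path_ratio \<rho> L ^ (n - m) = path_ratio \<rho> p"
    using closed_walk_ratio_prod[OF u(1) fin closed, where d = d, of "\<lambda>f. f"] unfolding L_eq
    by blast
  have p_arcs: "set p \<subseteq> arcs G"
    using awalk_set[OF p(1)] .
  have "path_ratio \<rho> L ^ (n - m) < 1"
    using path_ratio_less_1[OF L_arcs circuit(2)] L_pos mn(1) by (intro power_less_one_iff[THEN iffD2]) auto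
  then have "p \<noteq> []"
    using p(2) by auto
  then obtain e p' where e: "p = e # p'"
    by (cases p) auto
  \<comment> \<open>the first arc of \<open>p\<close> leaves \<open>u\<close>, which is not on the circuit\<close>
  have "e \<notin> set L"
  proof
    assume "e \<in> set L"
    then have "tail G e \<in> set (awalk_verts x L)"
      using awalk_verts_arc1 circuit(1) by auto
    moreover have "tail G e = u"
      using p(1) e by (simp add: awalk_Cons_iff)
    ultimately show False
      using u(2) by simp
  qed
  \<comment> \<open>dividing by the ratios of the arcs of \<open>p\<close> in \<open>L\<close> leaves the two products of hypothesis \<open>i\<close>\<close>
  define pin pout where "pin = filter (\<lambda>e. e \<in> set L) p" and "pout = filter (\<lambda>e. e \<notin> set L) p"
  have pout: "set pout \<subseteq> arcs G - set L" "pout \<noteq> []"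
    using p_arcs \<open>e \<notin> set L\<close> e by (auto simp: pout_def)
  have pin: "set pin \<subseteq> set L"
    by (auto simp: pin_def)
  have nz: "\<rho> e \<noteq> 0" if "e \<in> arcs G" for e
    using ratio_bounds[OF that] by simp
  have out: "path_ratio \<rho> pout \<in> rat_powers_nonneg_nz (abs_ratios \<rho> (arcs G - set L))"
    using pout nz by (intro path_ratio_in_rat_powers_nonneg_nz) auto
  have AL: "abs_ratios \<rho> (set L) \<subseteq> {0<..}"
    using L_arcs nz by (auto simp: abs_ratios_def)
  have inL: "path_ratio \<rho> r \<in> rat_powers (abs_ratios \<rho> (set L))" if "set r \<subseteq> set L" for r
    using that nz L_arcs by (intro path_ratio_in_rat_powers) auto
  have "path_ratio \<rho> L ^ (n - m) / path_ratio \<rho> pin \<in> rat_powers (abs_ratios \<rho> (set L))"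
    by (intro rat_powers_divide rat_powers_power AL inL pin order_refl)
  also have "path_ratio \<rho> L ^ (n - m) / path_ratio \<rho> pin = path_ratio \<rho> pout"
    using path_ratio_pos[OF order_trans[OF pin L_arcs]]
      path_ratio_filter[of \<rho> p "\<lambda>e. e \<in> set L"] p(2) by (simp add: pin_def pout_def)
  finally have "path_ratio \<rho> pout \<in> rat_powers (abs_ratios \<rho> (set L))" .
  moreover have "path_ratio \<rho> pout \<noteq> 1"
    using path_ratio_less_1[OF order_trans[OF pout(1) Diff_subset] pout(2)] by simp
  ultimately show False
    using out i by (auto simp: rat_powers_def)
qed

end
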